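(* Let either $r=1$ and $k=0$, or $r=2$ and $k\in\{0,1\}$. Then \[ \Gamma=\Gamma\left(D^k;L_2^r\right)=\Gamma_{-1}. \]
   Context: Let $\mathbb{I}=[-1,1]$, $L_2=L_2(\mathbb{I})$ (real-valued functions) with norm $\|f\|_2=\left(\int_{-1}^1|f(x)|^2\,dx\right)^{1/2}$, and $\|f\|_\infty=\operatorname{ess\,sup}_{x\in\mathbb{I}}|f(x)|$. $L_2^r$ is the space of functions $f:\mathbb{I}\to\mathbb{R}$ having absolutely continuous derivative $f^{(r-1)}$ and such that $f^{(r)}\in L_2$. Let $W^r_2=\{f\in L_2^r:\|f^{(r)}\|_2\leqslant 1\}$. $\Gamma=\Gamma(D^k;L_2^r)$ is the set of all pairs $(A,B)$ of non-negative (finite) numbers such that the inequality $\|f^{(k)}\|_\infty\leqslant A\|f\|_2+B\|f^{(r)}\|_2$ holds for every $f\in L_2^r$ and is sharp in the sense that $B$ is the smallest possible for the given $A$, i.e. \[ B=B(A)=\sup_{f\in W^r_2}\left(\|f^{(k)}\|_\infty-A\|f\|_2\right)<\infty . \] $\Gamma_{-1}=\Gamma(D^k_{-1};L_2^r)$ is the set of all pairs $(A,B)$ of non-negative (finite) numbers such that $|f^{(k)}(-1)|\leqslant A\|f\|_2+B\|f^{(r)}\|_2$ holds for every $f\in L_2^r$ and is sharp in the same sense, i.e. \[ B=B_{-1}(A)=\sup_{f\in W^r_2}\left(|f^{(k)}(-1)|-A\|f\|_2\right)<\infty . \] *)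

theory Defs
  imports "HOL-Analysis.Analysis" "HOL-Probability.Essential_Supremum"
begin

definition II :: "real set" where
  "II = {-1..1}"

text \<open>
  Functions on \<open>[-1,1]\<close> are represented by total functions on the reals. Every notion below depends
  only on their values on \<open>II\<close>; in particular the derivatives at the end points are one-sided.
\<close>

primrec ideriv :: "nat \<Rightarrow> (real \<Rightarrow> real) \<Rightarrow> real \<Rightarrow> real" where
  "ideriv 0 f = f"
| "ideriv (Suc j) f = (\<lambda>x. vector_derivative (ideriv j f) (at x within II))"

definition abs_continuous_on :: "real set \<Rightarrow> (real \<Rightarrow> real) \<Rightarrow> bool" where
  "abs_continuous_on S f \<longleftrightarrow>
    (\<forall>\<epsilon>>0. \<exists>\<delta>>0. \<forall>P :: (real \<times> real) set.
      finite P \<longrightarrow>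
      (\<forall>(a, b)\<in>P. a < b \<and> {a..b} \<subseteq> S) \<longrightarrow>
      pairwise (\<lambda>p q. disjnt {fst p<..<snd p} {fst q<..<snd q}) P \<longrightarrow>
      (\<Sum>(a, b)\<in>P. b - a) < \<delta> \<longrightarrow>
      (\<Sum>(a, b)\<in>P. \<bar>f b - f a\<bar>) < \<epsilon>)"

definition in_L2 :: "(real \<Rightarrow> real) \<Rightarrow> bool" where
  "in_L2 f \<longleftrightarrow> f \<in> borel_measurable (lebesgue_on II) \<and>
     integrable (lebesgue_on II) (\<lambda>x. \<bar>f x\<bar>\<^sup>2)"

definition norm2 :: "(real \<Rightarrow> real) \<Rightarrow> real" where
  "norm2 f = sqrt (LINT x|lebesgue_on II. \<bar>f x\<bar>\<^sup>2)"

definition norm_infty :: "(real \<Rightarrow> real) \<Rightarrow> ereal" where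
  "norm_infty f = esssup (lebesgue_on II) (\<lambda>x. ereal \<bar>f x\<bar>)"

text \<open>
  The space \<open>L\<^sub>2\<^sup>r\<close> for \<open>r \<ge> 1\<close>. The first conjunct says that \<open>f', \<dots>, f\<^sup>(\<^sup>r\<^sup>-\<^sup>1\<^sup>)\<close> exist everywhere on
  \<open>II\<close>. The derivative of order \<open>r\<close> of such a function exists only almost everywhere; where it does
  not exist, \<open>ideriv r f\<close> has an unspecified value, which affects neither \<open>in_L2\<close> nor \<open>norm2\<close>.
\<close>

definition L2r :: "nat \<Rightarrow> (real \<Rightarrow> real) set" where
  "L2r r = {f. (\<forall>j<r - 1. ideriv j f differentiable_on II) \<and>
               abs_continuous_on II (ideriv (r - 1) f) \<and>
               in_L2 (ideriv r f)}"

definition W2r :: "nat \<Rightarrow> (real \<Rightarrow> real) set" where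
  "W2r r = {f \<in> L2r r. norm2 (ideriv r f) \<le> 1}"

text \<open>
  The suprema are taken in the extended reals, so equating one with \<open>ereal B\<close> includes its finiteness.
\<close>

definition Gamma_D :: "nat \<Rightarrow> nat \<Rightarrow> (real \<times> real) set" where
  "Gamma_D k r = {(A, B). 0 \<le> A \<and> 0 \<le> B \<and>
     (\<forall>f\<in>L2r r. norm_infty (ideriv k f) \<le> ereal (A * norm2 f + B * norm2 (ideriv r f))) \<and>
     ereal B = (SUP f\<in>W2r r. norm_infty (ideriv k f) - ereal (A * norm2 f))}"

definition Gamma_D_m1 :: "nat \<Rightarrow> nat \<Rightarrow> (real \<times> real) set" where
  "Gamma_D_m1 k r = {(A, B). 0 \<le> A \<and> 0 \<le> B \<and>
     (\<forall>f\<in>L2r r. \<bar>ideriv k f (-1)\<bar> \<le> A * norm2 f + B * norm2 (ideriv r f)) \<and>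
     ereal B = (SUP f\<in>W2r r. ereal (\<bar>ideriv k f (-1)\<bar> - A * norm2 f))}"

end

theory Submission
  imports Defs
begin

text \<open>
  If the inequality holds at the end point \<open>-1\<close>, it holds with the same constants at every \<open>t \<in> [-1,1]\<close>.

  For \<open>k = 0\<close> one of the two affine maps of \<open>[-1,1]\<close> onto \<open>[t,1]\<close> or \<open>[-1,t]\<close> sending \<open>-1\<close> to \<open>t\<close> pulls \<open>f\<close>
  back to a function \<open>g\<close> with \<open>\<parallel>g\<parallel> \<le> \<parallel>f\<parallel>\<close>, because the two pieces of \<open>\<parallel>f\<parallel>\<^sup>2\<close> add up to the whole; the
  derivatives only get smaller.

  For \<open>r = 2\<close>, \<open>k = 1\<close>, by the Cauchy-Schwarz inequality it suffices to compare, for every \<open>w = 4\<kappa>\<^sup>4\<close>, the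
  norms of the functionals \<open>f \<mapsto> f'(t)\<close> with respect to the energy \<open>w \<parallel>f\<parallel>\<^sup>2 + \<parallel>f''\<parallel>\<^sup>2\<close>. The representer of
  this functional is an explicit piecewise solution of the beam equation \<open>g'''' = - w g\<close> with free ends, and
  its squared norm is proportional to its slope at \<open>t\<close>. That the slope is largest at the end points
  amounts to an inequality \<open>D(u,v) \<ge> 0\<close> between hyperbolic and trigonometric functions, which follows
  from the sign of the mixed derivatives \<open>\<partial>\<^sub>u\<^sup>2 \<partial>\<^sub>v\<^sup>2 D\<close>.

  Absolutely continuous functions enter through Lebesgue's theorem on almost everywhere
  differentiability and the corresponding fundamental theorem of calculus.
\<close>

subsection \<open>Absolutely continuous functions\<close>

text \<open>For the first derivative the affine pullback fails: it multiplies \<open>f'(t)\<close>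
  by the contraction ratio, and nothing makes up for this in the term with
  \<open>\<parallel>f\<parallel>\<close>. Hence the detour through quadratic energies, for which the
  best constant at each t is explicit; the linear bound is recovered by choosing the weight w
  according to the norms of f. The weight is written 4 \<kappa>^4 because the roots of s^4 = - 4
  \<kappa>^4 are \<kappa> (+-1 +- i), so the solutions of the beam equation are products of
  hyperbolic and trigonometric functions of \<kappa> x. The representer has a jump in its second
  derivative at t; the size of this jump does not depend on t, which is what reduces a comparison of
  norms to one of slopes. Sharpness is a separate matter: the least constant at -1 could be smaller
  than the one for the essential supremum. It is itself admissible at -1 by homogeneity, so it can
  be transported to every t, and the two constants agree.\<close>

lemma abs_continuous_on_subset:
  "abs_continuous_on S f \<Longrightarrow> T \<subseteq> S \<Longrightarrow> abs_continuous_on T f"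
  unfolding abs_continuous_on_def by (smt (verit, best) case_prodE case_prod_conv subset_trans case_prodD case_prodI2)

lemma abs_continuous_on_id: "abs_continuous_on S (\<lambda>x. x)"
  unfolding abs_continuous_on_def
proof (intro allI impI)
  fix e :: real assume "e > 0"
  show "\<exists>d>0. \<forall>P. finite P \<longrightarrow> (\<forall>(a, b)\<in>P. a < b \<and> {a..b} \<subseteq> S) \<longrightarrow>
      pairwise (\<lambda>p q. disjnt {fst p<..<snd p} {fst q<..<snd q}) P \<longrightarrow>
      (\<Sum>(a, b)\<in>P. b - a) < d \<longrightarrow> (\<Sum>(a, b)\<in>P. \<bar>b - a\<bar>) < e"
  proof (intro exI[of _ e] conjI allI impI)
    fix P :: "(real \<times> real) set"
    assume P: "\<forall>(a, b)\<in>P. a < b \<and> {a..b} \<subseteq> S" "(\<Sum>(a, b)\<in>P. b - a) < e"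
    have "(\<Sum>(a, b)\<in>P. \<bar>b - a\<bar>) = (\<Sum>(a, b)\<in>P. b - a)"
      using P(1) by (intro sum.cong) auto
    then show "(\<Sum>(a, b)\<in>P. \<bar>b - a\<bar>) < e" using P(2) by simp
  qed fact
qed

text \<open>Absolute continuity is checked by domination throughout: negation, differences, products
  and pointwise equality are instances, and so are C1 functions, which are dominated by the
  identity.\<close>

lemma abs_continuous_on_dominated:
  assumes f: "abs_continuous_on S f" and g: "abs_continuous_on S g"
    and F: "\<And>a b. a < b \<Longrightarrow> {a..b} \<subseteq> S \<Longrightarrow> \<bar>F b - F a\<bar> \<le> M * (\<bar>f b - f a\<bar> + \<bar>g b - g a\<bar>)"
  shows "abs_continuous_on S F"
  unfolding abs_continuous_on_def
proof (intro allI impI)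
  fix e :: real assume e: "e > 0"
  define e' where "e' = e / (2 * (\<bar>M\<bar> + 1))"
  have e': "e' > 0" using e by (simp add: e'_def)
  obtain d1 where d1: "d1 > 0" "\<And>P. finite P \<Longrightarrow> (\<forall>(a, b)\<in>P. a < b \<and> {a..b} \<subseteq> S) \<Longrightarrow>
      pairwise (\<lambda>p q. disjnt {fst p<..<snd p} {fst q<..<snd q}) P \<Longrightarrow>
      (\<Sum>(a, b)\<in>P. b - a) < d1 \<Longrightarrow> (\<Sum>(a, b)\<in>P. \<bar>f b - f a\<bar>) < e'"
    using f e' unfolding abs_continuous_on_def by meson
  obtain d2 where d2: "d2 > 0" "\<And>P. finite P \<Longrightarrow> (\<forall>(a, b)\<in>P. a < b \<and> {a..b} \<subseteq> S) \<Longrightarrow>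
      pairwise (\<lambda>p q. disjnt {fst p<..<snd p} {fst q<..<snd q}) P \<Longrightarrow>
      (\<Sum>(a, b)\<in>P. b - a) < d2 \<Longrightarrow> (\<Sum>(a, b)\<in>P. \<bar>g b - g a\<bar>) < e'"
    using g e' unfolding abs_continuous_on_def by meson
  show "\<exists>d>0. \<forall>P. finite P \<longrightarrow> (\<forall>(a, b)\<in>P. a < b \<and> {a..b} \<subseteq> S) \<longrightarrow>
      pairwise (\<lambda>p q. disjnt {fst p<..<snd p} {fst q<..<snd q}) P \<longrightarrow>
      (\<Sum>(a, b)\<in>P. b - a) < d \<longrightarrow> (\<Sum>(a, b)\<in>P. \<bar>F b - F a\<bar>) < e"
  proof (intro exI[of _ "min d1 d2"] conjI allI impI)
    fix P :: "(real \<times> real) set"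
    assume P: "finite P" "\<forall>(a, b)\<in>P. a < b \<and> {a..b} \<subseteq> S"
      "pairwise (\<lambda>p q. disjnt {fst p<..<snd p} {fst q<..<snd q}) P"
      "(\<Sum>(a, b)\<in>P. b - a) < min d1 d2"
    have 1: "(\<Sum>(a, b)\<in>P. \<bar>f b - f a\<bar>) < e'" using d1(2)[OF P(1-3)] P(4) by simp
    have 2: "(\<Sum>(a, b)\<in>P. \<bar>g b - g a\<bar>) < e'" using d2(2)[OF P(1-3)] P(4) by simp
    have "(\<Sum>(a, b)\<in>P. \<bar>F b - F a\<bar>) \<le> (\<Sum>(a, b)\<in>P. (\<bar>M\<bar> + 1) * (\<bar>f b - f a\<bar> + \<bar>g b - g a\<bar>))"
    proof (rule sum_mono)
      fix p assume "p \<in> P"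
      then obtain u v where p: "p = (u, v)" "u < v" "{u..v} \<subseteq> S" using P(2) by auto
      have "M * (\<bar>f v - f u\<bar> + \<bar>g v - g u\<bar>) \<le> (\<bar>M\<bar> + 1) * (\<bar>f v - f u\<bar> + \<bar>g v - g u\<bar>)"
        by (intro mult_right_mono) auto
      then show "(case p of (a, b) \<Rightarrow> \<bar>F b - F a\<bar>) \<le> (case p of (a, b) \<Rightarrow> (\<bar>M\<bar> + 1) * (\<bar>f b - f a\<bar> + \<bar>g b - g a\<bar>))"
        using F[OF p(2,3)] p(1) by simp
    qed
    also have "\<dots> = (\<bar>M\<bar> + 1) * ((\<Sum>(a, b)\<in>P. \<bar>f b - f a\<bar>) + (\<Sum>(a, b)\<in>P. \<bar>g b - g a\<bar>))"
      by (simp add: sum_distrib_left sum.distrib[symmetric] split_beta)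
    also have "\<dots> < (\<bar>M\<bar> + 1) * (e' + e')"
      using 1 2 by (intro mult_strict_left_mono) auto
    also have "\<dots> = e"
    proof -
      have *: "m * (e / (2 * m) + e / (2 * m)) = e" if "m \<noteq> 0" for m
        using that by (simp add: field_simps)
      show ?thesis unfolding e'_def by (rule *) linarith
    qed
    finally show "(\<Sum>(a, b)\<in>P. \<bar>F b - F a\<bar>) < e" .
  qed (use d1 d2 in auto)
qed

lemma abs_continuous_on_uminus: "abs_continuous_on S f \<Longrightarrow> abs_continuous_on S (\<lambda>x. - f x)"
  by (rule abs_continuous_on_dominated[where f = f and g = f and M = 1]) (auto simp: abs_minus_commute)

lemma abs_continuous_on_diff:
  "abs_continuous_on S f \<Longrightarrow> abs_continuous_on S g \<Longrightarrow> abs_continuous_on S (\<lambda>x. f x - g x)"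
  by (rule abs_continuous_on_dominated[where f = f and g = g and M = 1]) auto

lemma abs_continuous_on_imp_uniformly_continuous:
  assumes "abs_continuous_on {a..b} f"
  shows "uniformly_continuous_on {a..b} f"
  unfolding uniformly_continuous_on_def
proof (intro allI impI)
  fix e :: real assume "e > 0"
  then obtain d where d: "d > 0" "\<And>P. finite P \<Longrightarrow> (\<forall>(u, v)\<in>P. u < v \<and> {u..v} \<subseteq> {a..b}) \<Longrightarrow>
      pairwise (\<lambda>p q. disjnt {fst p<..<snd p} {fst q<..<snd q}) P \<Longrightarrow>
      (\<Sum>(u, v)\<in>P. v - u) < d \<Longrightarrow> (\<Sum>(u, v)\<in>P. \<bar>f v - f u\<bar>) < e"
    using assms unfolding abs_continuous_on_def by meson
  have *: "\<bar>f y - f x\<bar> < e" if "x < y" "x \<in> {a..b}" "y \<in> {a..b}" "y - x < d" for x y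
    using d(2)[of "{(x, y)}"] that by auto
  have "dist (f x') (f x) < e" if "x \<in> {a..b}" "x' \<in> {a..b}" "dist x' x < d" for x x'
    using *[of x x'] *[of x' x] that \<open>e > 0\<close>
    by (cases x x' rule: linorder_cases) (auto simp: dist_real_def abs_if split: if_splits)
  then show "\<exists>d>0. \<forall>x\<in>{a..b}. \<forall>x'\<in>{a..b}. dist x' x < d \<longrightarrow> dist (f x') (f x) < e"
    using d(1) by blast
qed

lemma abs_continuous_on_imp_continuous_on:
  "abs_continuous_on {a..b} f \<Longrightarrow> continuous_on {a..b} f"
  by (intro uniformly_continuous_imp_continuous abs_continuous_on_imp_uniformly_continuous)

lemma abs_continuous_on_mult:
  assumes f: "abs_continuous_on {a..b} f" and g: "abs_continuous_on {a..b} g"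
  shows "abs_continuous_on {a..b} (\<lambda>x. f x * g x)"
proof -
  have "bounded (f ` {a..b})" "bounded (g ` {a..b})"
    using f g by (auto intro!: compact_imp_bounded compact_continuous_image abs_continuous_on_imp_continuous_on)
  then obtain M N where M: "\<And>x. x \<in> {a..b} \<Longrightarrow> \<bar>f x\<bar> \<le> M" and N: "\<And>x. x \<in> {a..b} \<Longrightarrow> \<bar>g x\<bar> \<le> N"
    unfolding bounded_iff by (metis imageI real_norm_def)
  show ?thesis
  proof (rule abs_continuous_on_dominated[OF f g, where M = "\<bar>M\<bar> + \<bar>N\<bar>"])
    fix u v assume uv: "u < v" "{u..v} \<subseteq> {a..b}"
    then have *: "u \<in> {a..b}" "v \<in> {a..b}" by auto
    have "f v * g v - f u * g u = f v * (g v - g u) + g u * (f v - f u)" by (simp add: algebra_simps)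
    then have "\<bar>f v * g v - f u * g u\<bar> \<le> \<bar>f v\<bar> * \<bar>g v - g u\<bar> + \<bar>g u\<bar> * \<bar>f v - f u\<bar>"
      by (metis abs_mult abs_triangle_ineq)
    also have "\<dots> \<le> (\<bar>M\<bar> + \<bar>N\<bar>) * \<bar>g v - g u\<bar> + (\<bar>M\<bar> + \<bar>N\<bar>) * \<bar>f v - f u\<bar>"
      using M[OF *(2)] N[OF *(1)] by (intro add_mono mult_right_mono) auto
    finally show "\<bar>f v * g v - f u * g u\<bar> \<le> (\<bar>M\<bar> + \<bar>N\<bar>) * (\<bar>f v - f u\<bar> + \<bar>g v - g u\<bar>)"
      by (simp add: algebra_simps)
  qed
qed

lemma abs_continuous_on_C1:
  assumes f: "\<And>x. x \<in> {a..b} \<Longrightarrow> (f has_real_derivative f' x) (at x within {a..b})"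
    and f': "continuous_on {a..b} f'"
  shows "abs_continuous_on {a..b} f"
proof -
  obtain M where M: "\<And>x. x \<in> {a..b} \<Longrightarrow> \<bar>f' x\<bar> \<le> M"
    using compact_imp_bounded[OF compact_continuous_image[OF f']] unfolding bounded_iff
    by (metis compact_Icc imageI real_norm_def)
  show ?thesis
  proof (rule abs_continuous_on_dominated[OF abs_continuous_on_id abs_continuous_on_id, where M = M])
    fix u v assume uv: "u < v" "{u..v} \<subseteq> {a..b}"
    then have *: "u \<in> {a..b}" "v \<in> {a..b}" by auto
    have "norm (f v - f u) \<le> M * norm (v - u)"
      by (rule field_differentiable_bound[of "{a..b}"]) (use f M * in auto)
    moreover have "0 \<le> M" using M[OF *(1)] by linarith
    ultimately show "\<bar>f v - f u\<bar> \<le> M * (\<bar>v - u\<bar> + \<bar>v - u\<bar>)"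
      using uv(1) by (auto simp: algebra_simps intro: order_trans)
  qed
qed

text \<open>The gauge integral is built directly, so integrability of \<open>F'\<close> comes out
  rather than going in. At tags outside \<open>N\<close> the gauge makes \<open>F' x\<close>
  approximate the slope of \<open>F\<close> across the interval; at tags in \<open>N\<close> it
  confines the interval to a small open set \<open>T\<close>, where absolute continuity bounds the
  increments of \<open>F\<close>.\<close>

theorem FTC_abs_continuous:
  assumes ab: "a \<le> b" and F: "abs_continuous_on {a..b} F" and N: "negligible N"
    and F': "\<And>x. x \<in> {a..b} - N \<Longrightarrow> (F has_real_derivative F' x) (at x within {a..b})"
  shows "(F' has_integral (F b - F a)) {a..b}"
proof -
  \<comment> \<open>With value 0 on \<open>N\<close>, tags in \<open>N\<close> contribute nothing to
    a Riemann sum, whatever \<open>F'\<close> is there.\<close>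
  define F0 where "F0 x = (if x \<in> N then 0 else F' x)" for x
  have "(F0 has_integral (F b - F a)) {a..b}"
    unfolding has_integral_real
  proof (intro allI impI)
    fix e :: real assume e: "e > 0"
    define e1 where "e1 = e / (2 * (b - a + 1))"
    have e1: "e1 > 0" using e ab by (simp add: e1_def)
    obtain \<delta> where \<delta>: "\<delta> > 0" "\<And>P. finite P \<Longrightarrow> (\<forall>(u, v)\<in>P. u < v \<and> {u..v} \<subseteq> {a..b}) \<Longrightarrow>
        pairwise (\<lambda>p q. disjnt {fst p<..<snd p} {fst q<..<snd q}) P \<Longrightarrow>
        (\<Sum>(u, v)\<in>P. v - u) < \<delta> \<Longrightarrow> (\<Sum>(u, v)\<in>P. \<bar>F v - F u\<bar>) < e / 2"
      using F half_gt_zero[OF e] unfolding abs_continuous_on_def by meson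
    obtain T where T: "open T" "N \<subseteq> T" "T - N \<in> lmeasurable" "emeasure lebesgue (T - N) < ennreal \<delta>"
      using sets_lebesgue_outer_open[OF negligible_imp_sets[OF N] \<delta>(1)] by blast
    have "T = (T - N) \<union> N" using T(2) by auto
    then have Tm: "T \<in> lmeasurable"
      using T(3) negligible_imp_measurable[OF N] by (metis fmeasurable.Un)
    have "measure lebesgue T = measure lebesgue (T - N)"
      using N Tm by (simp add: measure_Diff_null_set negligible_iff_null_sets fmeasurableD)
    then have mT: "measure lebesgue T < \<delta>"
      using T(3,4) \<delta>(1) by (simp add: emeasure_eq_measure2 ennreal_less_iff)
    have "\<forall>x. \<exists>d>0. x \<in> {a..b} - N \<longrightarrow>
        (\<forall>y\<in>{a..b}. \<bar>y - x\<bar> < d \<longrightarrow> \<bar>F y - F x - F' x * (y - x)\<bar> \<le> e1 * \<bar>y - x\<bar>)"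
    proof
      fix x
      show "\<exists>d>0. x \<in> {a..b} - N \<longrightarrow>
        (\<forall>y\<in>{a..b}. \<bar>y - x\<bar> < d \<longrightarrow> \<bar>F y - F x - F' x * (y - x)\<bar> \<le> e1 * \<bar>y - x\<bar>)"
      proof (cases "x \<in> {a..b} - N")
        case True
        from F'[OF this] have "(F has_derivative (\<lambda>h. F' x * h)) (at x within {a..b})"
          by (simp add: has_field_derivative_def)
        then have "\<exists>d>0. \<forall>y\<in>{a..b}. norm (y - x) < d \<longrightarrow> norm (F y - F x - F' x * (y - x)) \<le> e1 * norm (y - x)"
          unfolding has_derivative_within_alt using e1 by blast
        then show ?thesis by auto
      qed (auto intro: exI[of _ 1])
    qed
    then obtain d where d: "\<And>x. d x > 0" "\<And>x y. x \<in> {a..b} - N \<Longrightarrow> y \<in> {a..b} \<Longrightarrow> \<bar>y - x\<bar> < d x \<Longrightarrow>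
        \<bar>F y - F x - F' x * (y - x)\<bar> \<le> e1 * \<bar>y - x\<bar>"
      by metis
    define \<gamma> where "\<gamma> x = (if x \<in> N then T else ball x (d x))" for x
    have gauge: "gauge \<gamma>" unfolding gauge_def \<gamma>_def using T(1,2) d(1) by auto
    have main: "norm ((\<Sum>(x, k)\<in>\<D>. measure lborel k *\<^sub>R F0 x) - (F b - F a)) < e"
      if D: "\<D> tagged_division_of {a..b}" "\<gamma> fine \<D>" for \<D>
    proof -
      have fin: "finite \<D>" using D(1) by blast
      have tel: "(\<Sum>(x, k)\<in>\<D>. F (Sup k) - F (Inf k)) = F b - F a"
        using additive_tagged_division_1[OF ab D(1)] .
      have len: "(\<Sum>(x, k)\<in>\<D>. Sup k - Inf k) = b - a"
        using additive_tagged_division_1[OF ab D(1), of "\<lambda>x. x"] .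
      have K: "\<exists>u v. k = {u..v} \<and> u \<le> v \<and> a \<le> u \<and> v \<le> b \<and> x \<in> {u..v} \<and> {u..v} \<subseteq> \<gamma> x"
        if "(x, k) \<in> \<D>" for x k
      proof -
        have "x \<in> k" "k \<subseteq> {a..b}" "\<exists>u v. k = cbox u v"
          using D(1) that by (auto simp: tagged_division_of_def tagged_partial_division_of_def)
        moreover have "k \<subseteq> \<gamma> x" using D(2) that unfolding fine_def by blast
        ultimately show ?thesis by fastforce
      qed
      define D1 where "D1 = {p \<in> \<D>. fst p \<in> N}"
      define D2 where "D2 = {p \<in> \<D>. fst p \<notin> N}"
      have D12: "\<D> = D1 \<union> D2" "D1 \<inter> D2 = {}" "finite D1" "finite D2"
        using fin by (auto simp: D1_def D2_def)
      \<comment> \<open>Degenerate intervals are dropped: absolute continuity speaks only of a < b,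
        and distinct nondegenerate intervals of a division have distinct pairs of end points, which
        gives injectivity.\<close>
      define D3 where "D3 = {p \<in> D1. Inf (snd p) < Sup (snd p)}"
      have D3: "D3 \<subseteq> \<D>" "finite D3" using fin by (auto simp: D3_def D1_def)
      define P where "P = (\<lambda>p. (Inf (snd p), Sup (snd p))) ` D3"
      have disj: "disjnt {Inf (snd p)<..<Sup (snd p)} {Inf (snd q)<..<Sup (snd q)}"
        if "p \<in> \<D>" "q \<in> \<D>" "p \<noteq> q" for p q
      proof -
        obtain u v where p: "snd p = {u..v}" "u \<le> v" using K[of "fst p" "snd p"] \<open>p \<in> \<D>\<close> by auto
        obtain u' v' where q: "snd q = {u'..v'}" "u' \<le> v'" using K[of "fst q" "snd q"] \<open>q \<in> \<D>\<close> by auto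
        have "interior (snd p) \<inter> interior (snd q) = {}"
          using D(1) that unfolding tagged_division_of_def tagged_partial_division_of_def
          by (metis prod.collapse)
        then show ?thesis using p q by (simp add: disjnt_def)
      qed
      have inj: "inj_on (\<lambda>p. (Inf (snd p), Sup (snd p))) D3"
      proof (rule inj_onI)
        fix p q assume pq: "p \<in> D3" "q \<in> D3" "(Inf (snd p), Sup (snd p)) = (Inf (snd q), Sup (snd q))"
        show "p = q"
        proof (rule ccontr)
          assume "p \<noteq> q"
          then have "disjnt {Inf (snd p)<..<Sup (snd p)} {Inf (snd q)<..<Sup (snd q)}"
            using disj pq D3 by blast
          then show False using pq by (auto simp: disjnt_def D3_def dest: dense)
        qed
      qed
      have P1: "\<forall>(u, v)\<in>P. u < v \<and> {u..v} \<subseteq> {a..b} \<and> {u..v} \<subseteq> T"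
      proof clarify
        fix u v assume "(u, v) \<in> P"
        then obtain x k where xk: "(x, k) \<in> D3" "u = Inf k" "v = Sup k" by (auto simp: P_def)
        with K[of x k] D3(1) obtain u' v' where "k = {u'..v'}" "u' \<le> v'" "a \<le> u'" "v' \<le> b" "{u'..v'} \<subseteq> \<gamma> x"
          by blast
        then show "u < v \<and> {u..v} \<subseteq> {a..b} \<and> {u..v} \<subseteq> T"
          using xk by (auto simp: D3_def D1_def \<gamma>_def)
      qed
      have P2: "pairwise (\<lambda>p q. disjnt {fst p<..<snd p} {fst q<..<snd q}) P"
      proof (rule pairwiseI)
        fix i j assume ij: "i \<in> P" "j \<in> P" "i \<noteq> j"
        then obtain p q where "p \<in> D3" "q \<in> D3" "i = (Inf (snd p), Sup (snd p))" "j = (Inf (snd q), Sup (snd q))"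
          by (auto simp: P_def)
        moreover from this ij have "p \<noteq> q" by auto
        ultimately show "disjnt {fst i<..<snd i} {fst j<..<snd j}" using disj[of p q] D3(1) by auto
      qed
      have finP: "finite P" using D3 by (simp add: P_def)
      have "(\<Sum>(u, v)\<in>P. v - u) = (\<Sum>p\<in>P. measure lebesgue {fst p<..<snd p})"
        using P1 by (intro sum.cong) auto
      also have "\<dots> = measure lebesgue (\<Union>p\<in>P. {fst p<..<snd p})"
        using P2 finP by (intro measure_negligible_finite_Union_image[symmetric])
          (auto simp: pairwise_def disjnt_def)
      also have "\<dots> \<le> measure lebesgue T"
      proof (rule measure_mono_fmeasurable[OF _ _ Tm])
        show "(\<Union>p\<in>P. {fst p<..<snd p}) \<subseteq> T"
          using P1 by (auto simp: subset_iff split_beta)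
      qed (use finP in \<open>auto intro!: sets.finite_UN\<close>)
      finally have "(\<Sum>(u, v)\<in>P. v - u) < \<delta>" using mT by simp
      then have "(\<Sum>(u, v)\<in>P. \<bar>F v - F u\<bar>) < e / 2"
        using \<delta>(2)[OF finP _ P2] P1 by (auto simp: split_beta)
      also have "(\<Sum>(u, v)\<in>P. \<bar>F v - F u\<bar>) = (\<Sum>(x, k)\<in>D3. \<bar>F (Sup k) - F (Inf k)\<bar>)"
        unfolding P_def by (subst sum.reindex[OF inj]) (simp add: split_beta o_def)
      also have "\<dots> = (\<Sum>(x, k)\<in>D1. \<bar>F (Sup k) - F (Inf k)\<bar>)"
      proof (rule sum.mono_neutral_left)
        show "\<forall>p\<in>D1 - D3. (case p of (x, k) \<Rightarrow> \<bar>F (Sup k) - F (Inf k)\<bar>) = 0"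
        proof clarify
          fix x k assume xk: "(x, k) \<in> D1" "(x, k) \<notin> D3"
          then obtain u v where "k = {u..v}" "u \<le> v" using K[of x k] by (auto simp: D1_def)
          with xk have "Sup k = Inf k" by (auto simp: D3_def)
          then show "\<bar>F (Sup k) - F (Inf k)\<bar> = 0" by simp
        qed
      qed (use D12 in \<open>auto simp: D3_def\<close>)
      finally have S1: "(\<Sum>(x, k)\<in>D1. \<bar>F (Sup k) - F (Inf k)\<bar>) < e / 2" .
      have S2: "(\<Sum>(x, k)\<in>D2. \<bar>measure lborel k *\<^sub>R F0 x - (F (Sup k) - F (Inf k))\<bar>) \<le> (\<Sum>(x, k)\<in>D2. e1 * (Sup k - Inf k))"
      proof (rule sum_mono, clarify)
        fix x k assume xk: "(x, k) \<in> D2"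
        then obtain u v where k: "k = {u..v}" "u \<le> v" "a \<le> u" "v \<le> b" "x \<in> {u..v}" "{u..v} \<subseteq> \<gamma> x"
          using K[of x k] by (auto simp: D2_def)
        have xN: "x \<notin> N" using xk by (simp add: D2_def)
        have "u \<in> ball x (d x)" "v \<in> ball x (d x)" using k(2,6) xN by (simp_all add: \<gamma>_def subset_iff)
        then have "\<bar>u - x\<bar> < d x" "\<bar>v - x\<bar> < d x" by (auto simp: dist_real_def abs_minus_commute)
        then have "\<bar>F u - F x - F' x * (u - x)\<bar> \<le> e1 * \<bar>u - x\<bar>" "\<bar>F v - F x - F' x * (v - x)\<bar> \<le> e1 * \<bar>v - x\<bar>"
          using d(2)[of x u] d(2)[of x v] k xN by auto
        moreover have "F0 x * (v - u) - (F v - F u) = (F u - F x - F' x * (u - x)) - (F v - F x - F' x * (v - x))"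
          using xN by (simp add: F0_def algebra_simps)
        moreover have "e1 * \<bar>u - x\<bar> + e1 * \<bar>v - x\<bar> = e1 * (v - u)"
          using k by (simp add: algebra_simps)
        ultimately have "\<bar>F0 x * (v - u) - (F v - F u)\<bar> \<le> e1 * (v - u)" by linarith
        then show "\<bar>measure lborel k *\<^sub>R F0 x - (F (Sup k) - F (Inf k))\<bar> \<le> e1 * (Sup k - Inf k)"
          using k by (simp add: mult.commute)
      qed
      also have "\<dots> \<le> (\<Sum>(x, k)\<in>\<D>. e1 * (Sup k - Inf k))"
      proof (rule sum_mono2)
        fix p assume "p \<in> \<D> - D2"
        then show "0 \<le> (case p of (x, k) \<Rightarrow> e1 * (Sup k - Inf k))"
          using K[of "fst p" "snd p"] e1 by (auto simp: split_beta)
      qed (use fin D12 in auto)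
      also have "\<dots> = e1 * (b - a)" by (simp add: len[symmetric] sum_distrib_left split_beta)
      also have "\<dots> < e / 2" using e ab by (simp add: e1_def field_simps)
      finally have S2: "(\<Sum>(x, k)\<in>D2. \<bar>measure lborel k *\<^sub>R F0 x - (F (Sup k) - F (Inf k))\<bar>) < e / 2" .
      have "norm ((\<Sum>(x, k)\<in>\<D>. measure lborel k *\<^sub>R F0 x) - (F b - F a)) =
          \<bar>\<Sum>(x, k)\<in>\<D>. measure lborel k *\<^sub>R F0 x - (F (Sup k) - F (Inf k))\<bar>"
        by (simp add: tel[symmetric] sum_subtractf split_beta)
      also have "\<dots> \<le> (\<Sum>(x, k)\<in>\<D>. \<bar>measure lborel k *\<^sub>R F0 x - (F (Sup k) - F (Inf k))\<bar>)"
        by (rule order_trans[OF sum_abs]) (simp add: split_beta)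
      also have "\<dots> = (\<Sum>(x, k)\<in>D1. \<bar>measure lborel k *\<^sub>R F0 x - (F (Sup k) - F (Inf k))\<bar>)
          + (\<Sum>(x, k)\<in>D2. \<bar>measure lborel k *\<^sub>R F0 x - (F (Sup k) - F (Inf k))\<bar>)"
        using D12 by (simp add: sum.union_disjoint)
      also have "(\<Sum>(x, k)\<in>D1. \<bar>measure lborel k *\<^sub>R F0 x - (F (Sup k) - F (Inf k))\<bar>) = (\<Sum>(x, k)\<in>D1. \<bar>F (Sup k) - F (Inf k)\<bar>)"
        by (intro sum.cong) (auto simp: D1_def F0_def)
      finally show ?thesis using S1 S2 by linarith
    qed
    show "\<exists>\<gamma>. gauge \<gamma> \<and> (\<forall>\<D>. \<D> tagged_division_of {a..b} \<and> \<gamma> fine \<D> \<longrightarrow>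
        norm ((\<Sum>(x, k)\<in>\<D>. measure lborel k *\<^sub>R F0 x) - (F b - F a)) < e)"
      by (intro exI[of _ \<gamma>] conjI allI impI gauge) (elim conjE, rule main)
  qed
  then show ?thesis
    by (rule has_integral_spike[OF N, rotated]) (simp add: F0_def)
qed

subsection \<open>Almost everywhere differentiability\<close>

definition steep_cover :: "real \<Rightarrow> real \<Rightarrow> (real \<Rightarrow> real) \<Rightarrow> real \<Rightarrow> real \<Rightarrow> real set" where
  "steep_cover a b f p d =
     \<Union>{{u<..<v} | u v. a \<le> u \<and> u < v \<and> v \<le> b \<and> v - u < d \<and> p * (v - u) < f v - f u}"

text \<open>
  Requiring the steep intervals to surround the point makes the following set a \<open>G\<^sub>\<delta>\<close> for any \<open>f\<close>.
\<close>

definition steep_points :: "real \<Rightarrow> real \<Rightarrow> (real \<Rightarrow> real) \<Rightarrow> real \<Rightarrow> real set" where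
  "steep_points a b f p = (\<Inter>n. steep_cover a b f p (1 / real (Suc n)))"

lemma steep_cover_iff:
  "x \<in> steep_cover a b f p d \<longleftrightarrow>
    (\<exists>u v. a \<le> u \<and> u < x \<and> x < v \<and> v \<le> b \<and> v - u < d \<and> p * (v - u) < f v - f u)"
proof
  assume "x \<in> steep_cover a b f p d"
  then obtain u v where "x \<in> {u<..<v}" "a \<le> u" "v \<le> b" "v - u < d" "p * (v - u) < f v - f u"
    unfolding steep_cover_def by blast
  then show "\<exists>u v. a \<le> u \<and> u < x \<and> x < v \<and> v \<le> b \<and> v - u < d \<and> p * (v - u) < f v - f u"
    by (intro exI[of _ u] exI[of _ v]) simp
next
  assume "\<exists>u v. a \<le> u \<and> u < x \<and> x < v \<and> v \<le> b \<and> v - u < d \<and> p * (v - u) < f v - f u"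
  then obtain u v where uv: "a \<le> u" "u < x" "x < v" "v \<le> b" "v - u < d" "p * (v - u) < f v - f u"
    by blast
  then have "x \<in> {u<..<v}" "u < v" by auto
  with uv show "x \<in> steep_cover a b f p d" unfolding steep_cover_def by blast
qed

lemma steep_points_subset: "steep_points a b f p \<subseteq> {a<..<b}"
proof
  fix x assume "x \<in> steep_points a b f p"
  then have "x \<in> steep_cover a b f p (1 / real (Suc 0))" unfolding steep_points_def by blast
  then show "x \<in> {a<..<b}" by (auto simp: steep_cover_iff)
qed

lemma steep_points_iff:
  "x \<in> steep_points a b f p \<longleftrightarrow> (\<forall>d>0. x \<in> steep_cover a b f p d)"
proof
  assume x: "x \<in> steep_points a b f p"
  show "\<forall>d>0. x \<in> steep_cover a b f p d"
  proof (intro allI impI)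
    fix d :: real assume "d > 0"
    then obtain n where "1 / real (Suc n) < d" by (meson nat_approx_posE)
    moreover have "x \<in> steep_cover a b f p (1 / real (Suc n))" using x by (auto simp: steep_points_def)
    ultimately show "x \<in> steep_cover a b f p d" unfolding steep_cover_iff by (meson less_trans)
  qed
qed (auto simp: steep_points_def)

lemma steep_points_antimono: "p \<le> q \<Longrightarrow> steep_points a b f q \<subseteq> steep_points a b f p"
proof (intro subsetI)
  fix x assume pq: "p \<le> q" and x: "x \<in> steep_points a b f q"
  have "x \<in> steep_cover a b f p d" if d: "d > 0" for d
  proof -
    obtain u v where uv: "a \<le> u" "u < x" "x < v" "v \<le> b" "v - u < d" "q * (v - u) < f v - f u"
      using x d unfolding steep_points_iff steep_cover_iff by blast
    moreover have "p * (v - u) \<le> q * (v - u)" using pq uv by (intro mult_right_mono) auto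
    ultimately have "p * (v - u) < f v - f u" by linarith
    then show ?thesis unfolding steep_cover_iff using uv by blast
  qed
  then show "x \<in> steep_points a b f p" by (simp add: steep_points_iff)
qed

lemma lmeasurable_steep_points [simp]: "steep_points a b f p \<in> lmeasurable"
proof -
  have "open (steep_cover a b f p d)" for d
    unfolding steep_cover_def by (rule open_Union) auto
  then have "steep_points a b f p \<in> sets lebesgue"
    unfolding steep_points_def by (intro sets.countable_INT) auto
  then show ?thesis
    using bounded_subset[OF bounded_box[of a b], unfolded box_real, OF steep_points_subset]
    by (rule bounded_set_imp_lmeasurable[rotated])
qed

text \<open>Arbitrarily short steep intervals surround each point of \<open>E\<close>, so those
  inside the open set \<open>T\<close> form a Vitali covering. The covering theorem is applied to
  balls, hence the midpoints \<open>c\<close> and radii \<open>r\<close>; a finite part of the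
  countable disjoint family captures all but \<open>e\<close> of the measure.\<close>

lemma Vitali_steep_intervals:
  assumes E: "E \<subseteq> steep_points a b f p" "E \<in> lmeasurable" and T: "open T" "E \<subseteq> T" and e: "e > 0"
  obtains P where "finite P"
    "\<And>u v. (u, v) \<in> P \<Longrightarrow> a \<le> u \<and> u < v \<and> v \<le> b \<and> {u..v} \<subseteq> T \<and> p * (v - u) < f v - f u"
    "pairwise (\<lambda>i j. disjnt {fst i..snd i} {fst j..snd j}) P"
    "measure lebesgue E - e < measure lebesgue (E \<inter> (\<Union>i\<in>P. {fst i..snd i}))"
proof -
  define K where "K = {(u, v). a \<le> u \<and> u < v \<and> v \<le> b \<and> {u..v} \<subseteq> T \<and> p * (v - u) < f v - f u}"
  define c where "c i = (fst i + snd i) / 2" for i :: "real \<times> real"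
  define r where "r i = (snd i - fst i) / 2" for i :: "real \<times> real"
  have cb: "cball (c i) (r i) = {fst i..snd i}" for i
    unfolding cball_eq_atLeastAtMost c_def r_def by (simp add: field_simps)
  have cov: "\<exists>i. i \<in> K \<and> x \<in> cball (c i) (r i) \<and> r i < d" if x: "x \<in> E" and d: "0 < d" for x d
  proof -
    obtain s where s: "s > 0" "ball x s \<subseteq> T" using T x by (meson openE subsetD)
    have "x \<in> steep_cover a b f p (min d s)"
      using x E(1) d s by (auto simp: steep_points_iff)
    then obtain u v where uv: "a \<le> u" "u < x" "x < v" "v \<le> b" "v - u < min d s" "p * (v - u) < f v - f u"
      unfolding steep_cover_iff by blast
    have "{u..v} \<subseteq> ball x s" using uv by (auto simp: dist_real_def)
    then have "(u, v) \<in> K" using uv s by (auto simp: K_def)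
    moreover have "r (u, v) < d" using uv d by (simp add: r_def)
    ultimately show ?thesis using uv cb[of "(u, v)"] by (intro exI[of _ "(u, v)"]) auto
  qed
  have r0: "0 < r i" if "i \<in> K" for i using that by (auto simp: K_def r_def)
  obtain C where C: "countable C" "C \<subseteq> K"
      "pairwise (\<lambda>i j. disjnt (cball (c i) (r i)) (cball (c j) (r j))) C"
      "negligible (E - (\<Union>i\<in>C. cball (c i) (r i)))"
    by (rule Vitali_covering_theorem_cballs[of K r E c, OF r0 cov])
  define DD where "DD = (\<lambda>i. E \<inter> {fst i..snd i}) ` C"
  have DD: "countable DD" "\<And>D. D \<in> DD \<Longrightarrow> D \<in> lmeasurable"
    using C(1) E(2) by (auto simp: DD_def intro: fmeasurable.Int)
  have "measure lebesgue (\<Union>D') \<le> measure lebesgue E" if "D' \<subseteq> DD" "finite D'" for D'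
    using that E(2) DD(2) by (intro measure_mono_fmeasurable) (auto simp: DD_def intro!: sets.finite_Union fmeasurableD)
  then obtain D' where D': "D' \<subseteq> DD" "finite D'" "measure lebesgue (\<Union>DD) - e < measure lebesgue (\<Union>D')"
    using measure_countable_Union_approachable[OF DD(1) e DD(2)] by blast
  obtain P where P: "P \<subseteq> C" "finite P" "D' = (\<lambda>i. E \<inter> {fst i..snd i}) ` P"
    using finite_subset_image[OF D'(2)] D'(1) unfolding DD_def by blast
  have UD: "\<Union>D' = E \<inter> (\<Union>i\<in>P. {fst i..snd i})" using P by auto
  have U: "\<Union>DD = E - (E - (\<Union>i\<in>C. cball (c i) (r i)))" unfolding DD_def cb by auto
  have "measure lebesgue (\<Union>DD) = measure lebesgue E"
    unfolding U using C(4) E(2) by (intro measure_Diff_null_set) (auto simp: negligible_iff_null_sets)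
  then have "measure lebesgue E - e < measure lebesgue (E \<inter> (\<Union>i\<in>P. {fst i..snd i}))"
    using D'(3) UD by simp
  moreover have "pairwise (\<lambda>i j. disjnt {fst i..snd i} {fst j..snd j}) P"
    using C(3) P(1) unfolding cb by (rule pairwise_subset)
  moreover have "a \<le> u \<and> u < v \<and> v \<le> b \<and> {u..v} \<subseteq> T \<and> p * (v - u) < f v - f u" if "(u, v) \<in> P" for u v
  proof -
    have "(u, v) \<in> K" using \<open>(u, v) \<in> P\<close> P(1) C(2) by blast
    then show ?thesis by (simp add: K_def)
  qed
  ultimately show ?thesis
    using P(2) by (intro that[of P])
qed

text \<open>Removing one interval and recursing on its two sides produces the gaps. The increment
  identity holds for every \<open>f\<close> at once, since it is needed both for lengths (the
  identity function) and for the increments of a given function.\<close>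

lemma complementary_intervals:
  fixes c d :: real
  assumes "finite P" "c \<le> d" "\<And>u v. (u, v) \<in> P \<Longrightarrow> c \<le> u \<and> u < v \<and> v \<le> d"
    "pairwise (\<lambda>i j. disjnt {fst i..snd i} {fst j..snd j}) P"
  shows "\<exists>R. finite R \<and> (\<forall>(u, v)\<in>R. c \<le> u \<and> u < v \<and> v \<le> d) \<and>
      pairwise (\<lambda>i j. disjnt {fst i<..<snd i} {fst j<..<snd j}) R \<and>
      (\<forall>f::real\<Rightarrow>real. (\<Sum>(u, v)\<in>P. f v - f u) + (\<Sum>(u, v)\<in>R. f v - f u) = f d - f c)"
  using assms
proof (induction "card P" arbitrary: P c d rule: less_induct)
  case less
  show ?case
  proof (cases "P = {}")
    case True
    show ?thesis
    proof (cases "c < d")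
      case c: True
      show ?thesis by (rule exI[of _ "{(c, d)}"]) (use c True in auto)
    next
      case c: False
      then have "c = d" using less.prems(2) by simp
      then show ?thesis by (intro exI[of _ "{}"]) (use True in auto)
    qed
  next
    case False
    then obtain u v where uv: "(u, v) \<in> P" by auto
    have uv': "c \<le> u" "u < v" "v \<le> d" using less.prems(3)[OF uv] by auto
    define P1 where "P1 = {i \<in> P. snd i < u}"
    define P2 where "P2 = {i \<in> P. v < fst i}"
    have split: "P = insert (u, v) (P1 \<union> P2)"
    proof -
      have "snd i < u \<or> v < fst i" if i: "i \<in> P" "i \<noteq> (u, v)" for i
      proof -
        have "disjnt {fst i..snd i} {u..v}" using pairwiseD[OF less.prems(4) i(1) uv i(2)] by simp
        moreover have "fst i < snd i" using less.prems(3)[of "fst i" "snd i"] i by simp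
        ultimately have "max (fst i) u \<notin> {fst i..snd i} \<or> max (fst i) u \<notin> {u..v}"
          by (auto simp: disjnt_def)
        then show ?thesis using \<open>fst i < snd i\<close> uv'(2) by auto
      qed
      then show ?thesis using uv by (auto simp: P1_def P2_def)
    qed
    have fin: "finite P1" "finite P2" using less.prems(1) by (auto simp: P1_def P2_def)
    have ne: "(u, v) \<notin> P1" "(u, v) \<notin> P2" using uv' by (auto simp: P1_def P2_def)
    have lt: "(u', v') \<in> P \<Longrightarrow> u' < v'" for u' v' using less.prems(3) by blast
    have dj: "P1 \<inter> P2 = {}" using uv' lt by (fastforce simp: P1_def P2_def)
    have card: "card P1 < card P" "card P2 < card P"
      using psubset_card_mono[OF less.prems(1)] ne uv split by blast+
    have pw: "pairwise (\<lambda>i j. disjnt {fst i..snd i} {fst j..snd j}) P1"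
       "pairwise (\<lambda>i j. disjnt {fst i..snd i} {fst j..snd j}) P2"
      using less.prems(4) by (auto intro: pairwise_subset simp: P1_def P2_def)
    have in1: "c \<le> u' \<and> u' < v' \<and> v' \<le> u" if "(u', v') \<in> P1" for u' v'
      using that less.prems(3) by (auto simp: P1_def less_imp_le)
    have in2: "v \<le> u' \<and> u' < v' \<and> v' \<le> d" if "(u', v') \<in> P2" for u' v'
      using that less.prems(3) by (auto simp: P2_def less_imp_le)
    obtain R1 where R1: "finite R1" "\<forall>(u', v')\<in>R1. c \<le> u' \<and> u' < v' \<and> v' \<le> u"
      "pairwise (\<lambda>i j. disjnt {fst i<..<snd i} {fst j<..<snd j}) R1"
      "\<And>f::real\<Rightarrow>real. (\<Sum>(u, v)\<in>P1. f v - f u) + (\<Sum>(u, v)\<in>R1. f v - f u) = f u - f c"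
      using less.hyps[OF card(1) fin(1) uv'(1) in1 pw(1)] by blast
    obtain R2 where R2: "finite R2" "\<forall>(u', v')\<in>R2. v \<le> u' \<and> u' < v' \<and> v' \<le> d"
      "pairwise (\<lambda>i j. disjnt {fst i<..<snd i} {fst j<..<snd j}) R2"
      "\<And>f::real\<Rightarrow>real. (\<Sum>(u, v)\<in>P2. f v - f u) + (\<Sum>(u, v)\<in>R2. f v - f u) = f d - f v"
      using less.hyps[OF card(2) fin(2) uv'(3) in2 pw(2)] by blast
    have R12: "R1 \<inter> R2 = {}" using R1(2) R2(2) uv' by fastforce
    have "\<forall>(u', v')\<in>R1 \<union> R2. c \<le> u' \<and> u' < v' \<and> v' \<le> d" using R1(2) R2(2) uv' by fastforce
    moreover have "pairwise (\<lambda>i j. disjnt {fst i<..<snd i} {fst j<..<snd j}) (R1 \<union> R2)"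
    proof -
      have "disjnt {fst i<..<snd i} {fst j<..<snd j}" if "i \<in> R1" "j \<in> R2" for i j
        using R1(2) R2(2) that uv' by (fastforce simp: disjnt_def)
      then show ?thesis using R1(3) R2(3) unfolding pairwise_def by (metis Un_iff disjnt_sym)
    qed
    moreover have "(\<Sum>(u, v)\<in>P. f v - f u) + (\<Sum>(u, v)\<in>R1 \<union> R2. f v - f u) = f d - f c" for f :: "real \<Rightarrow> real"
    proof -
      have "(\<Sum>(u, v)\<in>P. f v - f u) = (f v - f u) + ((\<Sum>(u, v)\<in>P1. f v - f u) + (\<Sum>(u, v)\<in>P2. f v - f u))"
        by (subst split) (use fin ne dj in \<open>simp add: sum.union_disjoint\<close>)
      moreover have "(\<Sum>(u, v)\<in>R1 \<union> R2. f v - f u) = (\<Sum>(u, v)\<in>R1. f v - f u) + (\<Sum>(u, v)\<in>R2. f v - f u)"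
        using R1(1) R2(1) R12 by (simp add: sum.union_disjoint)
      ultimately show ?thesis using R1(4)[of f] R2(4)[of f] by simp
    qed
    moreover have "finite (R1 \<union> R2)" using R1(1) R2(1) by simp
    ultimately show ?thesis by (intro exI[of _ "R1 \<union> R2"] conjI allI)
  qed
qed

text \<open>
  Vitali intervals with slope \<open>> p\<close> are chosen inside Vitali intervals with slope \<open>< q\<close>. The gaps have small
  total length, so absolute continuity makes the increments over them negligible; this replaces the
  monotonicity in the usual proof of Lebesgue's theorem.
\<close>

theorem negligible_steep_points_Int:
  assumes f: "abs_continuous_on {a..b} f" and pq: "q < p"
  shows "negligible (steep_points a b f p \<inter> steep_points a b (\<lambda>x. - f x) (- q))"
proof (rule ccontr)
  define E where "E = steep_points a b f p \<inter> steep_points a b (\<lambda>x. - f x) (- q)"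
  assume "\<not> negligible (steep_points a b f p \<inter> steep_points a b (\<lambda>x. - f x) (- q))"
  then have neg: "\<not> negligible E" by (simp add: E_def)
  have Em: "E \<in> lmeasurable" unfolding E_def by (intro fmeasurable.Int) auto
  define m where "m = measure lebesgue E"
  have "m \<noteq> 0" using neg negligible_iff_measure0[OF Em] by (simp add: m_def)
  then have m: "m > 0" by (simp add: m_def less_le)
  \<comment> \<open>Chosen for the final contradiction: \<open>(p - q) * lP\<close> will be below
    \<open>2 * \<eta>\<close>, yet at least \<open>3 * \<eta>\<close> because \<open>lP\<close> is
    at least 3/4 of \<open>m\<close>.\<close>
  define \<eta> where "\<eta> = (p - q) * m / 4"
  have \<eta>: "\<eta> > 0" using m pq by (simp add: \<eta>_def)
  obtain \<delta> where \<delta>: "\<delta> > 0" "\<And>P. finite P \<Longrightarrow> (\<forall>(u, v)\<in>P. u < v \<and> {u..v} \<subseteq> {a..b}) \<Longrightarrow>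
      pairwise (\<lambda>p q. disjnt {fst p<..<snd p} {fst q<..<snd q}) P \<Longrightarrow>
      (\<Sum>(u, v)\<in>P. v - u) < \<delta> \<Longrightarrow> (\<Sum>(u, v)\<in>P. \<bar>f v - f u\<bar>) < \<eta>"
    using f \<eta> unfolding abs_continuous_on_def by meson
  \<comment> \<open>The three bounds make the total gap length, below \<open>3 * e\<close>,
    admissible for \<open>\<delta>\<close>; the loss \<open>2 * e\<close> in \<open>lP\<close> at
    most a quarter of \<open>m\<close>; and \<open>\<bar>q\<bar>\<close> times the gap length at
    most \<open>\<eta>\<close>.\<close>
  define e where "e = min (\<delta> / 3) (min (m / 8) (\<eta> / (3 * (\<bar>q\<bar> + 1))))"
  have e: "e > 0" using \<delta>(1) m \<eta> by (simp add: e_def)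
  have "e \<le> \<delta> / 3" "e \<le> m / 8" and e0: "e \<le> \<eta> / (3 * (\<bar>q\<bar> + 1))"
    unfolding e_def by (simp_all only: min.cobounded1 min.coboundedI2 min.cobounded2)
  then have e1: "3 * e \<le> \<delta>" "8 * e \<le> m" by linarith+
  have "e * (3 * (\<bar>q\<bar> + 1)) \<le> \<eta>"
    by (subst pos_le_divide_eq[symmetric]) (use e0 in auto)
  then have e2: "3 * \<bar>q\<bar> * e \<le> \<eta>" using e by (simp add: algebra_simps)
  obtain T where T: "open T" "E \<subseteq> T" "T - E \<in> lmeasurable" "emeasure lebesgue (T - E) < ennreal e"
    using sets_lebesgue_outer_open[OF fmeasurableD[OF Em] e] by blast
  have TE: "T = (T - E) \<union> E" using T(2) by auto
  then have Tm: "T \<in> lmeasurable" using T(3) Em by (metis fmeasurable.Un)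
  have "measure lebesgue (T - E) < e"
    using T(3,4) e by (simp add: emeasure_eq_measure2 ennreal_less_iff)
  moreover have "measure lebesgue (T - E) = measure lebesgue T - m"
    unfolding m_def using Tm Em T(2) by (intro measurable_measure_Diff) auto
  ultimately have mT: "measure lebesgue T < m + e" by linarith
  obtain Q where Q: "finite Q"
    "\<And>u v. (u, v) \<in> Q \<Longrightarrow> a \<le> u \<and> u < v \<and> v \<le> b \<and> {u..v} \<subseteq> T \<and> - q * (v - u) < - f v - (- f u)"
    "pairwise (\<lambda>i j. disjnt {fst i..snd i} {fst j..snd j}) Q"
    "measure lebesgue E - e < measure lebesgue (E \<inter> (\<Union>i\<in>Q. {fst i..snd i}))"
    by (rule Vitali_steep_intervals[of E a b "\<lambda>x. - f x" "- q", OF _ Em T(1,2) e]) (auto simp: E_def)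
  have lenQ: "(\<Sum>(u, v)\<in>Q. v - u) < m + e"
  proof -
    have "(\<Sum>(u, v)\<in>Q. v - u) = (\<Sum>i\<in>Q. measure lebesgue {fst i..snd i})"
      by (intro sum.cong) (auto dest!: Q(2))
    also have "\<dots> = measure lebesgue (\<Union>i\<in>Q. {fst i..snd i})"
      using Q(1,3) by (intro measure_negligible_finite_Union_image[symmetric])
        (auto simp: pairwise_def disjnt_def)
    also have "\<dots> \<le> measure lebesgue T"
    proof (rule measure_mono_fmeasurable[OF _ _ Tm])
      show "(\<Union>i\<in>Q. {fst i..snd i}) \<subseteq> T"
      proof (rule UN_least)
        fix i assume "i \<in> Q"
        then show "{fst i..snd i} \<subseteq> T" using Q(2)[of "fst i" "snd i"] by simp
      qed
    qed (use Q(1) in \<open>auto intro!: sets.finite_UN\<close>)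
    finally show ?thesis using mT by linarith
  qed
  \<comment> \<open>The inner coverings then lose at most \<open>e\<close> in total; adding 1 keeps
    the quotient positive for empty \<open>Q\<close>.\<close>
  define e3 where "e3 = e / real (card Q + 1)"
  have e3: "e3 > 0" using e by (simp add: e3_def)
  define good where "good i P \<longleftrightarrow> finite P \<and>
    (\<forall>(u, v)\<in>P. fst i \<le> u \<and> u < v \<and> v \<le> snd i \<and> p * (v - u) < f v - f u) \<and>
    pairwise (\<lambda>i j. disjnt {fst i..snd i} {fst j..snd j}) P \<and>
    measure lebesgue (E \<inter> {fst i..snd i}) - e3 < (\<Sum>(u, v)\<in>P. v - u)" for i P
  have "\<exists>P. good i P" for i
  proof -
    \<comment> \<open>\<open>Vitali_steep_intervals\<close> wants an open surrounding set; the two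
      end points dropped here have measure zero.\<close>
    define E1 where "E1 = E \<inter> {fst i<..<snd i}"
    have E1m: "E1 \<in> lmeasurable" unfolding E1_def using Em by (intro fmeasurable.Int) auto
    obtain P where P: "finite P"
      "\<And>u v. (u, v) \<in> P \<Longrightarrow> a \<le> u \<and> u < v \<and> v \<le> b \<and> {u..v} \<subseteq> {fst i<..<snd i} \<and> p * (v - u) < f v - f u"
      "pairwise (\<lambda>i j. disjnt {fst i..snd i} {fst j..snd j}) P"
      "measure lebesgue E1 - e3 < measure lebesgue (E1 \<inter> (\<Union>i\<in>P. {fst i..snd i}))"
      by (rule Vitali_steep_intervals[of E1 a b f p, OF _ E1m open_greaterThanLessThan _ e3])
        (auto simp: E_def E1_def)
    have "measure lebesgue (E1 \<inter> (\<Union>i\<in>P. {fst i..snd i})) \<le> measure lebesgue (\<Union>i\<in>P. {fst i..snd i})"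
      using P(1) E1m by (intro measure_mono_fmeasurable) (auto intro!: fmeasurable.finite_UN sets.finite_UN)
    also have "\<dots> = (\<Sum>i\<in>P. measure lebesgue {fst i..snd i})"
      using P(1,3) by (intro measure_negligible_finite_Union_image) (auto simp: pairwise_def disjnt_def)
    also have "\<dots> = (\<Sum>(u, v)\<in>P. v - u)"
      by (intro sum.cong) (auto dest!: P(2))
    finally have 1: "measure lebesgue E1 - e3 < (\<Sum>(u, v)\<in>P. v - u)" using P(4) by linarith
    have "measure lebesgue (E \<inter> {fst i..snd i}) = measure lebesgue E1"
    proof (rule measure_negligible_symdiff)
      show "negligible ((E1 - E \<inter> {fst i..snd i}) \<union> (E \<inter> {fst i..snd i} - E1))"
        by (rule negligible_subset[of "{fst i, snd i}"]) (auto simp: E1_def)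
    qed (use E1m in auto)
    then have "measure lebesgue (E \<inter> {fst i..snd i}) - e3 < (\<Sum>(u, v)\<in>P. v - u)"
      using 1 by simp
    moreover have "\<forall>(u, v)\<in>P. fst i \<le> u \<and> u < v \<and> v \<le> snd i \<and> p * (v - u) < f v - f u"
    proof clarify
      fix u v assume "(u, v) \<in> P"
      from P(2)[OF this] have "u < v" "u \<in> {fst i<..<snd i}" "v \<in> {fst i<..<snd i}" "p * (v - u) < f v - f u"
        by (simp_all add: subset_iff)
      then show "fst i \<le> u \<and> u < v \<and> v \<le> snd i \<and> p * (v - u) < f v - f u" by auto
    qed
    ultimately show ?thesis unfolding good_def using P(1,3) by (intro exI[of _ P] conjI)
  qed
  then obtain P where "\<And>i. good i (P i)" by metis
  then have P: "\<And>i. finite (P i)"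
    "\<And>i. \<forall>(u, v)\<in>P i. fst i \<le> u \<and> u < v \<and> v \<le> snd i \<and> p * (v - u) < f v - f u"
    "\<And>i. pairwise (\<lambda>i j. disjnt {fst i..snd i} {fst j..snd j}) (P i)"
    "\<And>i. measure lebesgue (E \<inter> {fst i..snd i}) - e3 < (\<Sum>(u, v)\<in>P i. v - u)"
    unfolding good_def by auto
  define compl where "compl i R \<longleftrightarrow> finite R \<and> (\<forall>(u, v)\<in>R. fst i \<le> u \<and> u < v \<and> v \<le> snd i) \<and>
      pairwise (\<lambda>i j. disjnt {fst i<..<snd i} {fst j<..<snd j}) R \<and>
      (\<forall>f::real\<Rightarrow>real. (\<Sum>(u, v)\<in>P i. f v - f u) + (\<Sum>(u, v)\<in>R. f v - f u) = f (snd i) - f (fst i))" for i R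
  have "\<exists>R. compl i R" if "i \<in> Q" for i
  proof -
    have "fst i \<le> snd i" using Q(2)[of "fst i" "snd i"] that by simp
    then show ?thesis
      unfolding compl_def using P(2)[of i] by (intro complementary_intervals P(1,3)) auto
  qed
  then obtain R where "\<And>i. i \<in> Q \<Longrightarrow> compl i (R i)" by metis
  then have R: "\<And>i. i \<in> Q \<Longrightarrow> finite (R i)"
    "\<And>i. i \<in> Q \<Longrightarrow> \<forall>(u, v)\<in>R i. fst i \<le> u \<and> u < v \<and> v \<le> snd i"
    "\<And>i. i \<in> Q \<Longrightarrow> pairwise (\<lambda>i j. disjnt {fst i<..<snd i} {fst j<..<snd j}) (R i)"
    "\<And>i (f::real\<Rightarrow>real). i \<in> Q \<Longrightarrow>
       (\<Sum>(u, v)\<in>P i. f v - f u) + (\<Sum>(u, v)\<in>R i. f v - f u) = f (snd i) - f (fst i)"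
    unfolding compl_def by auto
  define RR where "RR = (\<Union>i\<in>Q. R i)"
  have finRR: "finite RR" using Q(1) R(1) by (simp add: RR_def)
  have dR: "disjnt {fst r<..<snd r} {fst s<..<snd s}"
    if "i \<in> Q" "j \<in> Q" "i \<noteq> j" "r \<in> R i" "s \<in> R j" for i j r s
  proof -
    have "{fst r<..<snd r} \<subseteq> {fst i..snd i}" "{fst s<..<snd s} \<subseteq> {fst j..snd j}"
      using R(2)[OF that(1)] R(2)[OF that(2)] that(4,5) by (auto simp: split_beta)
    then show ?thesis using pairwiseD[OF Q(3) that(1-3)] unfolding disjnt_def by blast
  qed
  have djR: "R i \<inter> R j = {}" if "i \<in> Q" "j \<in> Q" "i \<noteq> j" for i j
  proof (rule ccontr)
    assume "R i \<inter> R j \<noteq> {}"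
    then obtain r where r: "r \<in> R i" "r \<in> R j" by auto
    then have "fst r < snd r" using R(2)[OF that(1)] by (auto simp: split_beta)
    then show False using dR[OF that r] by (auto simp: disjnt_def dest: dense)
  qed
  have sumR: "(\<Sum>(u, v)\<in>RR. g v - g u) = (\<Sum>i\<in>Q. \<Sum>(u, v)\<in>R i. g v - g u)" for g :: "real \<Rightarrow> real"
    unfolding RR_def using Q(1) R(1) djR by (intro sum.UNION_disjoint) auto
  have tot: "(\<Sum>i\<in>Q. \<Sum>(u, v)\<in>P i. g v - g u) + (\<Sum>(u, v)\<in>RR. g v - g u) = (\<Sum>(u, v)\<in>Q. g v - g u)"
    for g :: "real \<Rightarrow> real"
  proof -
    have "(\<Sum>(u, v)\<in>Q. g v - g u) = (\<Sum>i\<in>Q. (\<Sum>(u, v)\<in>P i. g v - g u) + (\<Sum>(u, v)\<in>R i. g v - g u))"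
    proof (rule sum.cong)
      fix i assume "i \<in> Q"
      show "(case i of (u, v) \<Rightarrow> g v - g u) = (\<Sum>(u, v)\<in>P i. g v - g u) + (\<Sum>(u, v)\<in>R i. g v - g u)"
        unfolding R(4)[OF \<open>i \<in> Q\<close>] by (simp add: split_beta)
    qed simp
    then show ?thesis by (simp add: sumR sum.distrib)
  qed
  define lP where "lP = (\<Sum>i\<in>Q. \<Sum>(u, v)\<in>P i. v - u)"
  define lQ where "lQ = (\<Sum>(u, v)\<in>Q. v - u)"
  define lR where "lR = (\<Sum>(u, v)\<in>RR. v - u)"
  have tot_len: "lP + lR = lQ" using tot[of "\<lambda>x. x"] by (simp add: lP_def lQ_def lR_def)
  have lR0: "lR \<ge> 0" unfolding lR_def
  proof (rule sum_nonneg)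
    fix r assume "r \<in> RR"
    then obtain i where "i \<in> Q" "r \<in> R i" by (auto simp: RR_def)
    then show "0 \<le> (case r of (u, v) \<Rightarrow> v - u)" using R(2)[of i] by (auto simp: split_beta)
  qed
  have lP: "lP > m - 2 * e"
  proof -
    have "measure lebesgue (E \<inter> (\<Union>i\<in>Q. {fst i..snd i})) = measure lebesgue (\<Union>i\<in>Q. E \<inter> {fst i..snd i})"
      by (simp only: Int_UN_distrib)
    also have "\<dots> \<le> (\<Sum>i\<in>Q. measure lebesgue (E \<inter> {fst i..snd i}))"
      using Q(1) Em by (intro measure_UNION_le) auto
    also have "\<dots> \<le> (\<Sum>i\<in>Q. (\<Sum>(u, v)\<in>P i. v - u) + e3)"
      using P(4) by (intro sum_mono) (simp add: less_imp_le algebra_simps)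
    also have "\<dots> = lP + real (card Q) * e3" by (simp add: sum.distrib lP_def)
    also have "real (card Q) * e3 \<le> e" using e by (simp add: e3_def field_simps)
    finally show ?thesis using Q(4) by (simp add: m_def)
  qed
  have "lR < \<delta>" using tot_len lP lenQ e1 by (simp add: lQ_def)
  moreover have "\<forall>(u, v)\<in>RR. u < v \<and> {u..v} \<subseteq> {a..b}"
  proof clarify
    fix u v assume "(u, v) \<in> RR"
    then obtain i where i: "i \<in> Q" "(u, v) \<in> R i" by (auto simp: RR_def)
    then have "fst i \<le> u \<and> u < v \<and> v \<le> snd i" using R(2)[OF i(1)] by auto
    moreover have "a \<le> fst i \<and> snd i \<le> b" using Q(2)[of "fst i" "snd i"] i by simp
    ultimately show "u < v \<and> {u..v} \<subseteq> {a..b}" by auto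
  qed
  moreover have "pairwise (\<lambda>p q. disjnt {fst p<..<snd p} {fst q<..<snd q}) RR"
  proof (rule pairwiseI)
    fix r s assume rs: "r \<in> RR" "s \<in> RR" "r \<noteq> s"
    then obtain i j where "i \<in> Q" "j \<in> Q" "r \<in> R i" "s \<in> R j" by (auto simp: RR_def)
    then show "disjnt {fst r<..<snd r} {fst s<..<snd s}"
      using dR[of i j r s] pairwiseD[OF R(3), of i r s] rs(3) by (cases "i = j") auto
  qed
  ultimately have "(\<Sum>(u, v)\<in>RR. \<bar>f v - f u\<bar>) < \<eta>" using \<delta>(2)[OF finRR] by (simp add: lR_def)
  moreover have "- (\<Sum>(u, v)\<in>RR. \<bar>f v - f u\<bar>) \<le> (\<Sum>(u, v)\<in>RR. f v - f u)"
    unfolding sum_negf[symmetric] by (intro sum_mono) auto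
  ultimately have R\<eta>: "(\<Sum>(u, v)\<in>RR. f v - f u) > - \<eta>" by linarith
  have "p * lP \<le> (\<Sum>i\<in>Q. \<Sum>(u, v)\<in>P i. f v - f u)"
    unfolding lP_def sum_distrib_left using P(2) by (intro sum_mono) (auto simp: split_beta intro: less_imp_le)
  moreover have "(\<Sum>(u, v)\<in>Q. f v - f u) \<le> q * lQ"
    unfolding lQ_def sum_distrib_left 
  proof (rule sum_mono)
    fix i assume "i \<in> Q"
    then show "(case i of (u, v) \<Rightarrow> f v - f u) \<le> q * (case i of (u, v) \<Rightarrow> v - u)"
      using Q(2)[of "fst i" "snd i"] by (auto simp: split_beta)
  qed
  ultimately have "p * lP - \<eta> < q * lQ" using tot[of f] R\<eta> by linarith
  also have "q * lQ = q * lP + q * lR" by (simp add: tot_len[symmetric] algebra_simps)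
  also have "q * lR \<le> \<bar>q\<bar> * (3 * e)"
    using lR0 tot_len lP lenQ by (intro mult_mono) (auto simp: lQ_def)
  finally have "(p - q) * lP < 2 * \<eta>" using e2 by (simp add: algebra_simps)
  moreover have "(p - q) * (3 / 4 * m) \<le> (p - q) * lP"
    using lP e1 pq by (intro mult_left_mono) auto
  moreover have "(p - q) * (3 / 4 * m) = 3 * \<eta>" by (simp add: \<eta>_def)
  ultimately show False using \<eta> by linarith
qed

text \<open>In a window shorter than \<delta> the increments over disjoint intervals sum to less
  than 1, so intervals of slope above n have total length below 1/n. Hence the set is null in each
  window, and countably many windows with rational left ends cover it.\<close>

lemma negligible_infinitely_steep_points:
  assumes f: "abs_continuous_on {a..b} f"
  shows "negligible (\<Inter>n::nat. steep_points a b f (real n))"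
proof -
  define E where "E = (\<Inter>n::nat. steep_points a b f (real n))"
  have Em: "E \<in> sets lebesgue" unfolding E_def by (intro sets.countable_INT) (auto intro: fmeasurableD)
  obtain \<delta> where \<delta>: "\<delta> > 0" "\<And>P. finite P \<Longrightarrow> (\<forall>(u, v)\<in>P. u < v \<and> {u..v} \<subseteq> {a..b}) \<Longrightarrow>
      pairwise (\<lambda>p q. disjnt {fst p<..<snd p} {fst q<..<snd q}) P \<Longrightarrow>
      (\<Sum>(u, v)\<in>P. v - u) < \<delta> \<Longrightarrow> (\<Sum>(u, v)\<in>P. \<bar>f v - f u\<bar>) < 1"
    using f zero_less_one unfolding abs_continuous_on_def by meson
  have neg: "negligible (E \<inter> {c<..<c + \<delta> / 2})" for c
  proof -
    define E1 where "E1 = E \<inter> {c<..<c + \<delta> / 2}"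
    have E1m: "E1 \<in> lmeasurable" unfolding E1_def
      using Em by (intro bounded_set_imp_lmeasurable bounded_Int) auto
    have "measure lebesgue E1 \<le> 0 + e" if e: "e > 0" for e
    proof -
      obtain n where n: "real n > 2 / e" using reals_Archimedean2 by blast
      have n0: "n > 0" using n e by (cases n) (auto simp: field_simps)
      obtain P where P: "finite P"
        "\<And>u v. (u, v) \<in> P \<Longrightarrow> a \<le> u \<and> u < v \<and> v \<le> b \<and> {u..v} \<subseteq> {c<..<c + \<delta> / 2} \<and> real n * (v - u) < f v - f u"
        "pairwise (\<lambda>i j. disjnt {fst i..snd i} {fst j..snd j}) P"
        "measure lebesgue E1 - e / 2 < measure lebesgue (E1 \<inter> (\<Union>i\<in>P. {fst i..snd i}))"
        by (rule Vitali_steep_intervals[of E1 a b f "real n", OF _ E1m open_greaterThanLessThan _ half_gt_zero[OF e]])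
          (auto simp: E_def E1_def)
      define l where "l = (\<Sum>(u, v)\<in>P. v - u)"
      have l: "l = measure lebesgue (\<Union>i\<in>P. {fst i..snd i})"
      proof -
        have "l = (\<Sum>i\<in>P. measure lebesgue {fst i..snd i})"
          unfolding l_def by (intro sum.cong) (auto dest!: P(2))
        also have "\<dots> = measure lebesgue (\<Union>i\<in>P. {fst i..snd i})"
          using P(1,3) by (intro measure_negligible_finite_Union_image[symmetric])
            (auto simp: pairwise_def disjnt_def)
        finally show ?thesis .
      qed
      have "l \<le> measure lebesgue {c<..<c + \<delta> / 2}" unfolding l
      proof (rule measure_mono_fmeasurable)
        show "(\<Union>i\<in>P. {fst i..snd i}) \<subseteq> {c<..<c + \<delta> / 2}"
        proof (rule UN_least)
          fix i assume "i \<in> P"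
          then show "{fst i..snd i} \<subseteq> {c<..<c + \<delta> / 2}" using P(2)[of "fst i" "snd i"] by simp
        qed
      qed (use P(1) in \<open>auto intro!: sets.finite_UN\<close>)
      then have "l < \<delta>" using \<delta>(1) by simp
      moreover have "pairwise (\<lambda>p q. disjnt {fst p<..<snd p} {fst q<..<snd q}) P"
        using P(3) by (rule pairwise_mono) (auto simp: disjnt_def)
      moreover have "\<forall>(u, v)\<in>P. u < v \<and> {u..v} \<subseteq> {a..b}" by (auto dest!: P(2))
      ultimately have "(\<Sum>(u, v)\<in>P. \<bar>f v - f u\<bar>) < 1" using \<delta>(2)[OF P(1)] by (simp add: l_def)
      moreover have "real n * l \<le> (\<Sum>(u, v)\<in>P. \<bar>f v - f u\<bar>)"
        unfolding l_def sum_distrib_left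
      proof (rule sum_mono)
        fix i assume "i \<in> P"
        then show "real n * (case i of (u, v) \<Rightarrow> v - u) \<le> (case i of (u, v) \<Rightarrow> \<bar>f v - f u\<bar>)"
          using P(2)[of "fst i" "snd i"] by (auto simp: split_beta)
      qed
      ultimately have "real n * l < 1" by linarith
      then have "l < 1 / real n" using n0 by (simp add: field_simps)
      also have "1 / real n < e / 2" using n e n0 by (simp add: field_simps)
      finally have "l < e / 2" .
      moreover have "measure lebesgue (E1 \<inter> (\<Union>i\<in>P. {fst i..snd i})) \<le> l" unfolding l
        using P(1) E1m by (intro measure_mono_fmeasurable) (auto intro!: fmeasurable.finite_UN sets.finite_UN)
      ultimately show ?thesis using P(4) by simp
    qed
    then have "measure lebesgue E1 \<le> 0" by (rule field_le_epsilon)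
    then have "measure lebesgue E1 = 0" by (simp add: measure_le_0_iff)
    then show ?thesis using negligible_iff_measure0[OF E1m] by (simp add: E1_def)
  qed
  have "E \<subseteq> (\<Union>c\<in>\<rat>. E \<inter> {c<..<c + \<delta> / 2})"
  proof
    fix x assume "x \<in> E"
    obtain c where "c \<in> \<rat>" "x - \<delta> / 2 < c" "c < x" using Rats_dense_in_real[of "x - \<delta> / 2" x] \<delta>(1) by auto
    then show "x \<in> (\<Union>c\<in>\<rat>. E \<inter> {c<..<c + \<delta> / 2})" using \<open>x \<in> E\<close> by auto
  qed
  moreover have "negligible (\<Union>c\<in>\<rat>. E \<inter> {c<..<c + \<delta> / 2})"
    using neg by (intro negligible_countable_Union) (auto simp: countable_rat)
  ultimately show ?thesis unfolding E_def[symmetric] by (rule negligible_subset[rotated])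
qed

text \<open>Steepness concerns intervals around x, the derivative quotients with one end at x.
  Fixing one end at y and letting the other tend to x, continuity of \<open>f\<close> passes from
  the former to the latter.\<close>

lemma not_steep_point_bound:
  assumes f: "continuous_on {a..b} f" and x: "x \<in> {a<..<b}" "x \<notin> steep_points a b f p"
  obtains d where "d > 0" "\<And>y. y \<in> {a..b} \<Longrightarrow> y \<noteq> x \<Longrightarrow> \<bar>y - x\<bar> < d \<Longrightarrow> (f y - f x) / (y - x) \<le> p"
proof -
  obtain d where d: "d > 0" "x \<notin> steep_cover a b f p d" using x by (auto simp: steep_points_iff)
  have slope: "f v - f u \<le> p * (v - u)" if "a \<le> u" "u < x" "x < v" "v \<le> b" "v - u < d" for u v
    using d(2) that unfolding steep_cover_iff by (meson not_le)
  have cont: "isCont f x" using f x(1) by (metis at_within_Icc_at continuous_on_eq_continuous_within greaterThanLessThan_iff atLeastAtMost_iff less_imp_le)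
  have "(f y - f x) / (y - x) \<le> p" if y: "y \<in> {a..b}" "y \<noteq> x" "\<bar>y - x\<bar> < d" for y
  proof (cases "x < y")
    case True
    have ev: "\<forall>\<^sub>F u in at_left x. f y - f u \<le> p * (y - u)"
    proof -
      have "\<forall>\<^sub>F u in at_left x. u \<in> {max a (y - d)<..<x}"
        by (rule eventually_at_left_real) (use x y True in auto)
      then show ?thesis by eventually_elim (use y True in \<open>auto intro!: slope\<close>)
    qed
    have "f y - f x \<le> p * (y - x)"
    proof (rule tendsto_le[OF _ _ _ ev])
      have "isCont (\<lambda>u. f y - f u) x" using cont by (intro continuous_intros)
      then show "((\<lambda>u. f y - f u) \<longlongrightarrow> f y - f x) (at_left x)"
        by (meson isCont_def filterlim_at_split)
      show "((\<lambda>u. p * (y - u)) \<longlongrightarrow> p * (y - x)) (at_left x)" by (intro tendsto_intros)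
    qed simp
    then show ?thesis using True by (simp add: field_simps)
  next
    case False
    then have lt: "y < x" using y by auto
    have ev: "\<forall>\<^sub>F v in at_right x. f v - f y \<le> p * (v - y)"
    proof -
      have "\<forall>\<^sub>F v in at_right x. v \<in> {x<..<min b (y + d)}"
        by (rule eventually_at_right_real) (use x y lt in auto)
      then show ?thesis by eventually_elim (use y lt in \<open>auto intro!: slope\<close>)
    qed
    have "f x - f y \<le> p * (x - y)"
    proof (rule tendsto_le[OF _ _ _ ev])
      have "isCont (\<lambda>u. f u - f y) x" using cont by (intro continuous_intros)
      then show "((\<lambda>u. f u - f y) \<longlongrightarrow> f x - f y) (at_right x)"
        by (meson isCont_def filterlim_at_split)
      show "((\<lambda>u. p * (u - y)) \<longlongrightarrow> p * (x - y)) (at_right x)" by (intro tendsto_intros)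
    qed simp
    then show ?thesis using lt by (simp add: field_simps)
  qed
  then show ?thesis using that d(1) by blast
qed

text \<open>Off the exceptional set the derivative is the threshold \<open>L\<close>, the infimum of
  the slopes for which x is not steep. For p above \<open>L\<close> the quotients near x are at most
  p; for q below \<open>L\<close> the point is steep for some slope between q and \<open>L\<close>,
  hence not steep for \<open>- f\<close> at \<open>- q\<close>.\<close>

theorem abs_continuous_on_differentiable_AE:
  assumes f: "abs_continuous_on {a..b} f"
  obtains N where "negligible N"
    "\<And>x. x \<in> {a..b} - N \<Longrightarrow> \<exists>D. (f has_real_derivative D) (at x within {a..b})"
proof -
  define up where "up p = steep_points a b f p" for p
  define dn where "dn p = steep_points a b (\<lambda>x. - f x) (- p)" for p
  \<comment> \<open>The end points are included because steep points are interior. Rational pairs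
    keep the union countable; monotonicity in the slope recovers all pairs.\<close>
  define N where "N = {a, b} \<union> (\<Inter>n::nat. up (real n)) \<union> (\<Inter>n::nat. dn (- real n)) \<union>
    (\<Union>(q, p)\<in>{(q, p). q \<in> \<rat> \<and> p \<in> \<rat> \<and> q < p}. up p \<inter> dn q)"
  have cont: "continuous_on {a..b} f" by (rule abs_continuous_on_imp_continuous_on[OF f])
  have "countable {(q, p). q \<in> \<rat> \<and> p \<in> \<rat> \<and> q < (p::real)}"
    by (rule countable_subset[of _ "\<rat> \<times> \<rat>"]) (auto simp: countable_rat)
  then have "negligible (\<Union>(q, p)\<in>{(q, p). q \<in> \<rat> \<and> p \<in> \<rat> \<and> q < p}. up p \<inter> dn q)"
    using negligible_steep_points_Int[OF f] by (intro negligible_countable_Union) (auto simp: up_def dn_def)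
  then have N: "negligible N"
    unfolding N_def using negligible_infinitely_steep_points[OF f]
      negligible_infinitely_steep_points[OF abs_continuous_on_uminus[OF f]]
    by (intro negligible_Un) (auto simp: up_def dn_def)
  have "\<exists>D. (f has_real_derivative D) (at x within {a..b})" if x: "x \<in> {a..b} - N" for x
  proof -
    have xab: "x \<in> {a<..<b}" using x by (auto simp: N_def less_le)
    obtain n1 n2 :: nat where n: "x \<notin> up (real n1)" "x \<notin> dn (- real n2)" using x by (auto simp: N_def)
    have pq: "x \<notin> up p \<or> x \<notin> dn q" if qp: "q < p" for p q
    proof -
      obtain q' where q': "q' \<in> \<rat>" "q < q'" "q' < p" using Rats_dense_in_real[OF qp] by blast
      obtain p' where p': "p' \<in> \<rat>" "q' < p'" "p' < p" using Rats_dense_in_real[OF q'(3)] by blast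
      have "x \<notin> up p' \<or> x \<notin> dn q'" using x p' q' by (auto simp: N_def)
      moreover have "up p \<subseteq> up p'" "dn q \<subseteq> dn q'"
        unfolding up_def dn_def using p' q' by (auto intro!: steep_points_antimono)
      ultimately show ?thesis by blast
    qed
    have up_mono: "x \<notin> up q" if "x \<notin> up p" "p \<le> q" for p q
      using that steep_points_antimono[OF that(2), of a b f] by (auto simp: up_def)
    have dn_mono: "x \<notin> dn q" if "x \<notin> dn p" "q \<le> p" for p q
      using that steep_points_antimono[of "-p" "-q" a b "\<lambda>x. - f x"] by (auto simp: dn_def)
    define S where "S = {p. x \<notin> up p}"
    \<comment> \<open>For a smaller slope in \<open>S\<close>, the quotients at some y near x would
      be at most that slope and at the same time at least \<open>- real n2\<close>.\<close>
    have lower: "- real n2 - 1 \<le> p" if pS: "p \<in> S" for p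
    proof (rule ccontr)
      assume "\<not> - real n2 - 1 \<le> p"
      obtain d1 where d1: "d1 > 0" "\<And>y. y \<in> {a..b} \<Longrightarrow> y \<noteq> x \<Longrightarrow> \<bar>y - x\<bar> < d1 \<Longrightarrow> (f y - f x) / (y - x) \<le> p"
        by (rule not_steep_point_bound[OF cont xab]) (use pS in \<open>auto simp: S_def up_def\<close>)
      obtain d2 where d2: "d2 > 0" "\<And>y. y \<in> {a..b} \<Longrightarrow> y \<noteq> x \<Longrightarrow> \<bar>y - x\<bar> < d2 \<Longrightarrow> (- f y - - f x) / (y - x) \<le> real n2"
        by (rule not_steep_point_bound[of a b "\<lambda>x. - f x" x "real n2"])
          (use n(2) xab cont in \<open>auto simp: dn_def intro!: continuous_intros\<close>)
      define y where "y = x + min (b - x) (min d1 d2) / 2"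
      have "y > x" "y \<in> {a..b}" "\<bar>y - x\<bar> < d1" "\<bar>y - x\<bar> < d2"
        using xab d1(1) d2(1) by (auto simp: y_def min_def field_simps)
      then have "(f y - f x) / (y - x) \<le> p" "(- f y - - f x) / (y - x) \<le> real n2"
        using d1(2)[of y] d2(2)[of y] by auto
      moreover have "(- f y - - f x) / (y - x) = - ((f y - f x) / (y - x))" by (simp add: minus_divide_left)
      ultimately show False using \<open>\<not> - real n2 - 1 \<le> p\<close> by linarith
    qed
    have S: "S \<noteq> {}" "bdd_below S" using n(1) bdd_belowI[of S, OF lower] by (auto simp: S_def)
    define L where "L = Inf S"
    have upL: "x \<notin> up p" if "L < p" for p
    proof -
      obtain p' where "p' \<in> S" "p' < p" using cInf_lessD[OF S(1)] \<open>L < p\<close> by (auto simp: L_def)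
      then show ?thesis using up_mono[of p' p] by (simp add: S_def)
    qed
    have dnL: "x \<notin> dn q" if qL: "q < L" for q
    proof -
      obtain p where p: "q < p" "p < L" using dense[OF qL] by blast
      then have "p \<notin> S" using cInf_lower[OF _ S(2), of p] by (auto simp: L_def)
      then show ?thesis using pq[OF p(1)] by (simp add: S_def)
    qed
    have "((\<lambda>y. (f y - f x) / (y - x)) \<longlongrightarrow> L) (at x within {a..b})"
    proof (rule tendstoI)
      fix e :: real assume e: "e > 0"
      obtain d1 where d1: "d1 > 0" "\<And>y. y \<in> {a..b} \<Longrightarrow> y \<noteq> x \<Longrightarrow> \<bar>y - x\<bar> < d1 \<Longrightarrow> (f y - f x) / (y - x) \<le> L + e / 2"
        by (rule not_steep_point_bound[OF cont xab]) (use upL[of "L + e / 2"] e in \<open>auto simp: up_def\<close>)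
      obtain d2 where d2: "d2 > 0" "\<And>y. y \<in> {a..b} \<Longrightarrow> y \<noteq> x \<Longrightarrow> \<bar>y - x\<bar> < d2 \<Longrightarrow> (- f y - - f x) / (y - x) \<le> - (L - e / 2)"
        by (rule not_steep_point_bound[of a b "\<lambda>x. - f x" x "- (L - e / 2)"])
          (use dnL[of "L - e / 2"] e xab cont in \<open>auto simp: dn_def intro!: continuous_intros\<close>)
      show "\<forall>\<^sub>F y in at x within {a..b}. dist ((f y - f x) / (y - x)) L < e"
        unfolding eventually_at
      proof (intro exI[of _ "min d1 d2"] conjI ballI impI)
        fix y assume y: "y \<in> {a..b}" "y \<noteq> x \<and> dist y x < min d1 d2"
        then have "(f y - f x) / (y - x) \<le> L + e / 2" "(- f y - - f x) / (y - x) \<le> - (L - e / 2)"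
          using d1(2)[of y] d2(2)[of y] by (auto simp: dist_real_def)
        moreover have "(- f y - - f x) / (y - x) = - ((f y - f x) / (y - x))" by (simp add: minus_divide_left)
        ultimately show "dist ((f y - f x) / (y - x)) L < e" using e by (simp add: dist_real_def abs_less_iff)
      qed (use d1 d2 in auto)
    qed
    then show ?thesis unfolding has_field_derivative_iff by blast
  qed
  then show ?thesis using that N by blast
qed

subsection \<open>The representer of point evaluation of the derivative\<close>

lemma sinh_ge_self: "x \<le> sinh x" if "0 \<le> x" for x :: real
proof -
  have "sinh 0 - 0 \<le> sinh x - x"
    by (rule DERIV_nonneg_imp_nondecreasing[OF that])
      (auto intro!: exI derivative_eq_intros simp: cosh_real_ge_1)
  then show ?thesis by simp
qed

lemma abs_sin_le_sinh: "\<bar>sin x\<bar> \<le> sinh x" if "0 \<le> x" for x :: real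
  using abs_sin_x_le_abs_x[of x] sinh_ge_self[OF that] that by linarith

text \<open>Up to \<pi> both terms are nonnegative; beyond \<pi> already \<open>sinh x\<close>
  exceeds 3. The factor 3 is dictated by the mixed derivative in
  \<open>sinh_sin_inequality\<close>.\<close>

lemma sinh_plus_3_sin_nonneg: "0 \<le> sinh x + 3 * sin x" if "0 \<le> x" for x :: real
proof (cases "x \<le> pi")
  case True
  then show ?thesis using that sin_ge_zero[of x] by simp
next
  case False
  then have "3 \<le> sinh x" using sinh_ge_self[OF that] pi_gt3 by linarith
  then show ?thesis using sin_ge_minus_one[of x] by linarith
qed

lemma nonneg_of_deriv_nonneg:
  fixes f f' :: "real \<Rightarrow> real"
  assumes "0 \<le> x" "\<And>y. (f has_real_derivative f' y) (at y)" "\<And>y. 0 \<le> y \<Longrightarrow> 0 \<le> f' y" "0 \<le> f 0"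
  shows "0 \<le> f x"
proof -
  have "f 0 \<le> f x"
    by (rule DERIV_nonneg_imp_nondecreasing[OF assms(1)]) (use assms(2,3) in blast)
  then show ?thesis using assms(4) by linarith
qed

text \<open>Let D be the right side minus the left side. \<open>D1\<close>, ..., \<open>D4\<close>
  arise by differentiating D in v, u, v, u in turn. Integrating back from \<open>D4\<close> \<ge> 0
  needs the sign on one axis at each stage: D and \<open>D1\<close> vanish there, while
  \<open>D2\<close> and \<open>D3\<close> reduce to twice sinh - sin and twice cosh - cos. The
  weights 2 and 3 give equality on the axes, which correspond to t at an end point.\<close>

lemma sinh_sin_inequality:
  fixes u v :: real
  assumes u: "0 \<le> u" and v: "0 \<le> v"
  shows "2 * (sinh u + sinh v + sin u + sin v)
      + (sin u * cosh v + cos u * sinh v + sin v * cosh u + cos v * sinh u)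
    \<le> 3 * (sinh (u + v) + sin (u + v))"
proof -
  define D1 :: "real \<Rightarrow> real \<Rightarrow> real" where "D1 u v = 3 * (cosh (u + v) + cos (u + v)) - 2 * (cosh v + cos v)
      - (sin u * sinh v + cos u * cosh v + cos v * cosh u - sin v * sinh u)" for u v
  define D2 :: "real \<Rightarrow> real \<Rightarrow> real" where "D2 u v = 3 * (sinh (u + v) - sin (u + v))
      - (cos u * sinh v - sin u * cosh v + cos v * sinh u - sin v * cosh u)" for u v
  define D3 :: "real \<Rightarrow> real \<Rightarrow> real" where "D3 u v = 3 * (cosh (u + v) - cos (u + v))
      - (cos u * cosh v - sin u * sinh v - sin v * sinh u - cos v * cosh u)" for u v
  define D4 :: "real \<Rightarrow> real \<Rightarrow> real" where "D4 u v = 3 * (sinh (u + v) + sin (u + v))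
      + (sin u * cosh v + cos u * sinh v + sin v * cosh u + cos v * sinh u)" for u v
  have prod: "- sinh (u + v) \<le> sin u * cosh v + cos u * sinh v" if "0 \<le> u" "0 \<le> v" for u v :: real
  proof -
    have "- (sinh u * cosh v) \<le> sin u * cosh v"
      using mult_right_mono[of "- sinh u" "sin u" "cosh v"] abs_sin_le_sinh[OF that(1)] by simp
    moreover have "- (cosh u * sinh v) \<le> cos u * sinh v"
      using mult_right_mono[of "- cosh u" "cos u" "sinh v"] cos_ge_minus_one[of u] cosh_real_ge_1[of u] that
      by simp
    ultimately show ?thesis by (simp add: sinh_add)
  qed
  \<comment> \<open>Each of the two pairs of products costs at most one \<open>sinh (u + v)\<close>,
    so \<open>sinh (u + v) + 3 * sin (u + v)\<close> remains.\<close>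
  have D4: "0 \<le> D4 u v" if "0 \<le> u" "0 \<le> v" for u v
    using prod[of u v] prod[of v u] sinh_plus_3_sin_nonneg[of "u + v"] that
    by (simp add: D4_def add.commute)
  have D3: "0 \<le> D3 u v" if uv: "0 \<le> u" "0 \<le> v" for u v
  proof (rule nonneg_of_deriv_nonneg[OF uv(1), of "\<lambda>u. D3 u v" "\<lambda>u. D4 u v"])
    show "((\<lambda>u. D3 u v) has_real_derivative D4 y v) (at y)" for y
      unfolding D3_def D4_def by (auto intro!: derivative_eq_intros simp: algebra_simps)
    show "0 \<le> D3 0 v" using order_trans[OF cos_le_one cosh_real_ge_1, of v v] by (simp add: D3_def)
  qed (use D4 uv in auto)
  have D2: "0 \<le> D2 u v" if uv: "0 \<le> u" "0 \<le> v" for u v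
  proof (rule nonneg_of_deriv_nonneg[OF uv(2), of "\<lambda>v. D2 u v" "\<lambda>v. D3 u v"])
    show "((\<lambda>v. D2 u v) has_real_derivative D3 u y) (at y)" for y
      unfolding D2_def D3_def by (auto intro!: derivative_eq_intros simp: algebra_simps)
    show "0 \<le> D2 u 0" using abs_sin_le_sinh[OF uv(1)] by (simp add: D2_def)
  qed (use D3 uv in auto)
  have D1: "0 \<le> D1 u v" if uv: "0 \<le> u" "0 \<le> v" for u v
  proof (rule nonneg_of_deriv_nonneg[OF uv(1), of "\<lambda>u. D1 u v" "\<lambda>u. D2 u v"])
    show "((\<lambda>u. D1 u v) has_real_derivative D2 y v) (at y)" for y
      unfolding D1_def D2_def by (auto intro!: derivative_eq_intros simp: algebra_simps)
    show "0 \<le> D1 0 v" by (simp add: D1_def)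
  qed (use D2 uv in auto)
  have "0 \<le> 3 * (sinh (u + v) + sin (u + v)) - 2 * (sinh u + sinh v + sin u + sin v)
      - (sin u * cosh v + cos u * sinh v + sin v * cosh u + cos v * sinh u)"
  proof (rule nonneg_of_deriv_nonneg[OF v, of "\<lambda>v. 3 * (sinh (u + v) + sin (u + v)) - 2 * (sinh u + sinh v + sin u + sin v)
      - (sin u * cosh v + cos u * sinh v + sin v * cosh u + cos v * sinh u)" "\<lambda>v. D1 u v"])
    show "((\<lambda>v. 3 * (sinh (u + v) + sin (u + v)) - 2 * (sinh u + sinh v + sin u + sin v)
      - (sin u * cosh v + cos u * sinh v + sin v * cosh u + cos v * sinh u)) has_real_derivative D1 u y) (at y)" for y
      unfolding D1_def by (auto intro!: derivative_eq_intros simp: algebra_simps)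
  qed (use D1 u in auto)
  then show ?thesis by linarith
qed

section \<open>Krylov functions and the matching conditions of the representer at t\<close>

text \<open>
  Krylov's functions: solutions of \<open>y'''' = - 4 y\<close> whose derivatives of order \<open>0, \<dots>, 3\<close> at \<open>0\<close> are unit vectors.
\<close>

definition kry0 :: "real \<Rightarrow> real" where "kry0 x = cosh x * cos x"
definition kry1 :: "real \<Rightarrow> real" where "kry1 x = (sinh x * cos x + cosh x * sin x) / 2"
definition kry2 :: "real \<Rightarrow> real" where "kry2 x = sinh x * sin x / 2"
definition kry3 :: "real \<Rightarrow> real" where "kry3 x = (cosh x * sin x - sinh x * cos x) / 4"

lemma DERIV_kry:
  "(kry0 has_real_derivative - 4 * kry3 x) (at x)"
  "(kry1 has_real_derivative kry0 x) (at x)"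
  "(kry2 has_real_derivative kry1 x) (at x)"
  "(kry3 has_real_derivative kry2 x) (at x)"
  unfolding kry0_def kry1_def kry2_def kry3_def
  by (auto intro!: derivative_eq_intros simp: field_simps)

text \<open>
  With \<open>U\<close>, \<open>V\<close> the rescaled distances from \<open>t\<close> to the two ends, the reproducing kernel of the energy is, up
  to a factor, the bilinear form with the symmetric matrix \<open>M (U + V)\<close> in the free-end solutions
  \<open>kry0\<close>, \<open>kry1\<close> measured from the left and from the right end. Differentiating it in \<open>t\<close> gives the
  coefficients \<open>cA\<close>, \<open>cB\<close> of the representer of \<open>f'(t)\<close>: \<open>(cA U V, cB U V)\<close> to the left of \<open>t\<close> and
  \<open>(- cA V U, - cB V U)\<close> to the right.
\<close>

definition M11 :: "real \<Rightarrow> real" where "M11 z = (cos z * sinh z - cosh z * sin z) / 2"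
definition M12 :: "real \<Rightarrow> real" where "M12 z = sin z * sinh z"
definition M22 :: "real \<Rightarrow> real" where "M22 z = - (cosh z * sin z + cos z * sinh z)"

definition cA :: "real \<Rightarrow> real \<Rightarrow> real" where
  "cA U V = 4 * M11 (U + V) * kry3 V - M12 (U + V) * kry0 V"
definition cB :: "real \<Rightarrow> real \<Rightarrow> real" where
  "cB U V = 4 * M12 (U + V) * kry3 V - M22 (U + V) * kry0 V"

lemmas kern_defs = kry0_def kry1_def kry2_def kry3_def M11_def M12_def M22_def cA_def cB_def

text \<open>By the symmetry of the matrix M the slope is a symmetric form in the two distances, so
  both pieces have the same slope at t. Together with equal values and equal third derivatives, this
  leaves the second derivative as the only one to jump, which is what picks out \<open>f'(t)\<close>
  on integrating by parts.\<close>

lemma kern_slope: "- 4 * cA U V * kry3 U + cB U V * kry0 U = - 4 * cA V U * kry3 V + cB V U * kry0 V"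
  unfolding cA_def cB_def add.commute[of V U] by (simp add: algebra_simps)

lemma kern_value: "cA U V * kry0 U + cB U V * kry1 U = - (cA V U * kry0 V + cB V U * kry1 V)"
proof -
  \<comment> \<open>Every bracket is linear in \<open>p\<close> and \<open>r\<close> with
    coefficients depending on \<open>Z\<close> only, and in the sum the coefficients of
    \<open>p\<close> and of \<open>r\<close> cancel separately.\<close>
  define p where "p = cosh U * cosh V"
  define r where "r = cos U * cos V"
  define Z where "Z = U + V"
  have 1: "4 * (kry3 V * kry0 U + kry3 U * kry0 V) = p * sin Z - r * sinh Z"
    unfolding kern_defs p_def r_def Z_def sin_add sinh_add by (simp add: field_simps)
  have 2: "kry0 U * kry0 V - 2 * (kry3 V * kry1 U + kry3 U * kry1 V) = (p * cos Z + r * cosh Z) / 2"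
    unfolding kern_defs p_def r_def Z_def cos_add cosh_add by (simp add: field_simps)
  have 3: "kry0 V * kry1 U + kry0 U * kry1 V = (p * sin Z + r * sinh Z) / 2"
    unfolding kern_defs p_def r_def Z_def sin_add sinh_add by (simp add: field_simps)
  have "cA U V * kry0 U + cB U V * kry1 U + (cA V U * kry0 V + cB V U * kry1 V) =
      M11 Z * (4 * (kry3 V * kry0 U + kry3 U * kry0 V))
      - 2 * M12 Z * (kry0 U * kry0 V - 2 * (kry3 V * kry1 U + kry3 U * kry1 V))
      - M22 Z * (kry0 V * kry1 U + kry0 U * kry1 V)"
    unfolding cA_def cB_def add.commute[of V U] Z_def by (simp add: algebra_simps)
  also have "\<dots> = 0"
    unfolding 1 2 3 M11_def M12_def M22_def by (simp add: field_simps)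
  finally show ?thesis by simp
qed

lemma kern_third: "cA U V * kry1 U + cB U V * kry2 U = cA V U * kry1 V + cB V U * kry2 V"
proof -
  define Z where "Z = U + V"
  \<comment> \<open>Antisymmetry in \<open>U\<close> and \<open>V\<close> leaves only
    \<open>sinh W\<close> and \<open>sin W\<close>, each with a coefficient in \<open>Z\<close> that
    cancels.\<close>
  define W where "W = U - V"
  have 1: "4 * (kry3 V * kry1 U - kry3 U * kry1 V) = (sinh W * sin Z - sinh Z * sin W) / 2"
    unfolding kern_defs Z_def W_def sin_add sinh_add sin_diff sinh_diff by (simp add: field_simps)
  have 2: "kry0 V * kry1 U - kry0 U * kry1 V - 4 * (kry3 V * kry2 U - kry3 U * kry2 V)
      = (cos Z * sinh W + cosh Z * sin W) / 2"
    unfolding kern_defs Z_def W_def cos_add cosh_add sin_diff sinh_diff by (simp add: field_simps)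
  have 3: "kry0 V * kry2 U - kry0 U * kry2 V = (sinh Z * sin W + sinh W * sin Z) / 4"
    unfolding kern_defs Z_def W_def sin_add sinh_add sin_diff sinh_diff by (simp add: field_simps)
  have "cA U V * kry1 U + cB U V * kry2 U - (cA V U * kry1 V + cB V U * kry2 V) =
      M11 Z * (4 * (kry3 V * kry1 U - kry3 U * kry1 V))
      - M12 Z * (kry0 V * kry1 U - kry0 U * kry1 V - 4 * (kry3 V * kry2 U - kry3 U * kry2 V))
      - M22 Z * (kry0 V * kry2 U - kry0 U * kry2 V)"
    unfolding cA_def cB_def add.commute[of V U] Z_def by (simp add: algebra_simps)
  also have "\<dots> = 0"
    unfolding 1 2 3 M11_def M12_def M22_def by (simp add: field_simps)
  finally show ?thesis by simp
qed

text \<open>The jump of the second derivative depends on the total length \<open>U + V\<close> only.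
  The squared norm of the functional is the slope of this unnormalised representer divided by the
  jump, so moving t affects only the slope.\<close>

lemma kern_jump:
  "- 4 * (cA U V * kry2 U + cB U V * kry3 U) - 4 * (cA V U * kry2 V + cB V U * kry3 V)
    = sinh (U + V) ^ 2 - sin (U + V) ^ 2"
proof -
  define p where "p = cosh U * cosh V"
  define r where "r = cos U * cos V"
  define Z where "Z = U + V"
  have 1: "8 * (kry3 V * kry2 U + kry3 U * kry2 V) = (r - cos Z) * sinh Z - (cosh Z - p) * sin Z"
    unfolding kern_defs p_def r_def Z_def sin_add sinh_add cos_add cosh_add by (simp add: field_simps)
  have 2: "2 * (kry0 V * kry2 U + kry0 U * kry2 V - 8 * kry3 U * kry3 V)
      = sinh Z * sin Z - p * (r - cos Z) - (cosh Z - p) * r"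
    unfolding kern_defs p_def r_def Z_def sin_add sinh_add cos_add cosh_add by (simp add: field_simps)
  have 3: "4 * (kry0 V * kry3 U + kry0 U * kry3 V) = p * sin Z - r * sinh Z"
    unfolding kern_defs p_def r_def Z_def sin_add sinh_add by (simp add: field_simps)
  have "- 4 * (cA U V * kry2 U + cB U V * kry3 U) - 4 * (cA V U * kry2 V + cB V U * kry3 V) =
      - 2 * M11 Z * (8 * (kry3 V * kry2 U + kry3 U * kry2 V))
      + 2 * M12 Z * (2 * (kry0 V * kry2 U + kry0 U * kry2 V - 8 * kry3 U * kry3 V))
      + M22 Z * (4 * (kry0 V * kry3 U + kry0 U * kry3 V))"
    unfolding cA_def cB_def add.commute[of V U] Z_def by (simp add: algebra_simps)
  also have "\<dots> = cos Z ^ 2 * sinh Z ^ 2 - cosh Z ^ 2 * sin Z ^ 2 + 2 * sin Z ^ 2 * sinh Z ^ 2"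
    unfolding 1 2 3 M11_def M12_def M22_def by (simp add: field_simps power2_eq_square)
  also have "\<dots> = sinh Z ^ 2 - sin Z ^ 2"
    by (simp add: cos_squared_eq cosh_square_eq algebra_simps)
  finally show ?thesis by (simp add: Z_def)
qed

text \<open>The right-hand side is the value at the ends. In terms of the sum \<open>Z\<close> and
  the difference \<open>W\<close> of the distances, the claim becomes
  \<open>sinh_sin_inequality\<close> at the doubled distances \<open>Z + W\<close> and
  \<open>Z - W\<close>.\<close>

lemma kern_slope_le:
  assumes "0 \<le> U" "0 \<le> V"
  shows "- 4 * cA U V * kry3 U + cB U V * kry0 U \<le> sinh (U + V) * cosh (U + V) + sin (U + V) * cos (U + V)"
proof -
  define Z where "Z = U + V"
  define W where "W = U - V"
  have 1: "16 * (kry3 U * kry3 V) = (cosh Z * cos W - cosh W * cos Z - sinh Z * sin Z + sinh W * sin W) / 2"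
    unfolding kern_defs Z_def W_def sin_add sinh_add cos_add cosh_add sin_diff sinh_diff cos_diff cosh_diff
    by (simp add: field_simps)
  have 2: "4 * (kry0 V * kry3 U + kry0 U * kry3 V) = ((cosh Z + cosh W) * sin Z - (cos Z + cos W) * sinh Z) / 2"
    unfolding kern_defs Z_def W_def sin_add sinh_add cos_add cosh_add cos_diff cosh_diff
    by (simp add: field_simps)
  have 3: "kry0 U * kry0 V = (cosh Z + cosh W) * (cos Z + cos W) / 4"
    unfolding kern_defs Z_def W_def cos_add cosh_add cos_diff cosh_diff
    by (simp add: field_simps)
  have C: "cosh Z * cosh Z = 1 + sinh Z * sinh Z" "cos Z * cos Z = 1 - sin Z * sin Z"
    using cosh_square_eq[of Z] cos_squared_eq[of Z] by (simp_all add: power2_eq_square)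
  have "- 4 * cA U V * kry3 U + cB U V * kry0 U =
      - M11 Z * (16 * (kry3 U * kry3 V)) + M12 Z * (4 * (kry0 V * kry3 U + kry0 U * kry3 V))
      - M22 Z * (kry0 U * kry0 V)"
    unfolding cA_def cB_def add.commute[of V U] Z_def by (simp add: algebra_simps)
  also have "\<dots> = (sinh Z * cosh Z + sin Z * cos Z) / 4 + (sinh Z * cosh W + sin Z * cos W) / 2
      + (sin Z * cosh Z * (cosh W * cos W + sinh W * sin W) + cos Z * sinh Z * (cosh W * cos W - sinh W * sin W)) / 4"
    (is "?l = ?r")
  proof -
    \<comment> \<open>The two correction terms are multiples of the relations between squares,
      chosen so that the equation holds for arbitrary reals; they vanish by
      \<open>C\<close>.\<close>
    have "- ((c * S - C * s) / 2) * ((C * cW - CW * c - S * s + SW * sW) / 2)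
        + s * S * (((C + CW) * s - (c + cW) * S) / 2) - - (C * s + c * S) * ((C + CW) * (c + cW) / 4)
      = (S * C + s * c) / 4 + (S * CW + s * cW) / 2
        + (s * C * (CW * cW + SW * sW) + c * S * (CW * cW - SW * sW)) / 4
        + (C * C - (1 + S * S)) * (s * cW / 2 + s * c / 4)
        + (c * c - (1 - s * s)) * (S * CW / 2 + S * C / 4)" for S C s c SW CW sW cW :: real
      by (simp add: field_simps)
    from this[of "cos Z" "sinh Z" "cosh Z" "sin Z" "cos W" "cosh W" "sinh W" "sin W"] show ?thesis
      unfolding 1 2 3 M11_def M12_def M22_def by (simp add: C)
  qed
  finally have H: "- 4 * cA U V * kry3 U + cB U V * kry0 U = \<dots>" .
  have "2 * (sinh (Z + W) + sinh (Z - W) + sin (Z + W) + sin (Z - W))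
      + (sin (Z + W) * cosh (Z - W) + cos (Z + W) * sinh (Z - W) + sin (Z - W) * cosh (Z + W) + cos (Z - W) * sinh (Z + W))
    \<le> 3 * (sinh (Z + W + (Z - W)) + sin (Z + W + (Z - W)))"
    by (rule sinh_sin_inequality) (use assms in \<open>auto simp: Z_def W_def\<close>)
  also have "\<dots> = 6 * (sinh Z * cosh Z + sin Z * cos Z)"
    using sinh_double[of Z] sin_double[of Z] by simp
  also have "2 * (sinh (Z + W) + sinh (Z - W) + sin (Z + W) + sin (Z - W)) = 4 * (sinh Z * cosh W + sin Z * cos W)"
    unfolding sinh_add sinh_diff sin_add sin_diff by (simp add: algebra_simps)
  also have "sin (Z + W) * cosh (Z - W) + cos (Z + W) * sinh (Z - W) + sin (Z - W) * cosh (Z + W) + cos (Z - W) * sinh (Z + W)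
     = 2 * (sin Z * cosh Z * (cosh W * cos W + sinh W * sin W) + cos Z * sinh Z * (cosh W * cos W - sinh W * sin W))"
    unfolding sinh_add sinh_diff sin_add sin_diff cosh_add cosh_diff cos_add cos_diff by (simp add: algebra_simps)
  finally have le: "4 * (sinh Z * cosh W + sin Z * cos W)
      + 2 * (sin Z * cosh Z * (cosh W * cos W + sinh W * sin W) + cos Z * sinh Z * (cosh W * cos W - sinh W * sin W))
    \<le> 6 * (sinh Z * cosh Z + sin Z * cos Z)" .
  have "w / 4 + x / 2 + y / 4 \<le> w" if "4 * x + 2 * y \<le> 6 * w" for w x y :: real
    using that by linarith
  from this[OF le] show ?thesis unfolding H Z_def[symmetric] .
qed

text \<open>At distance 0, \<open>kry0\<close> is 1 and \<open>kry3\<close> is 0, so the slope is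
  \<open>cB\<close> alone; the bound of \<open>kern_slope_le\<close> is attained.\<close>

lemma kern_slope_end: "cB 0 Z = sinh Z * cosh Z + sin Z * cos Z"
proof -
  have C: "cosh Z * cosh Z = 1 + sinh Z * sinh Z" "cos Z * cos Z = 1 - sin Z * sin Z"
    using cosh_square_eq[of Z] cos_squared_eq[of Z] by (simp_all add: power2_eq_square)
  then show ?thesis unfolding kern_defs by simp algebra
qed

lemma kern_slope_end_pos: "0 < sinh z * cosh z + sin z * cos z" if "0 < z" for z :: real
proof -
  have "0 \<le> sinh (2 * z) + 3 * sin (2 * z)" using that by (intro sinh_plus_3_sin_nonneg) simp
  moreover have "0 < sinh (2 * z)" using that by simp
  ultimately have "0 < sinh (2 * z) + sin (2 * z)" by linarith
  then show ?thesis by (simp add: sinh_double sin_double)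
qed

subsection \<open>The spaces of the theorem\<close>

lemma II_sets [simp]: "II \<in> sets lebesgue" by (simp add: II_def)

text \<open>For the nonnegative square, gauge and Lebesgue integrability agree, which lets the
  calculus of gauge integrals serve norms defined by Lebesgue integrals.\<close>

lemma in_L2_iff:
  "in_L2 h \<longleftrightarrow> h measurable_on II \<and> (\<lambda>x. (h x)\<^sup>2) integrable_on II"
proof -
  have "integrable (lebesgue_on II) (\<lambda>x. (h x)\<^sup>2) \<longleftrightarrow> (\<lambda>x. (h x)\<^sup>2) absolutely_integrable_on II"
    by (simp add: integrable_restrict_space set_integrable_def)
  also have "\<dots> \<longleftrightarrow> (\<lambda>x. (h x)\<^sup>2) integrable_on II"
    by (rule absolutely_integrable_on_iff_nonneg) simp
  finally show ?thesis by (simp add: in_L2_def measurable_on_iff_borel_measurable)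
qed

lemma norm2_nonneg [simp]: "0 \<le> norm2 h"
  by (simp add: norm2_def)

lemma norm2_sq_has_integral:
  assumes "in_L2 h"
  shows "((\<lambda>x. (h x)\<^sup>2) has_integral (norm2 h)\<^sup>2) II"
proof -
  have "integrable (lebesgue_on II) (\<lambda>x. (h x)\<^sup>2)" using assms by (simp add: in_L2_def)
  from has_integral_integral_lebesgue_on[OF this II_sets] show ?thesis
    by (simp add: norm2_def)
qed

lemma norm2_eqI:
  assumes "in_L2 h" "((\<lambda>x. (h x)\<^sup>2) has_integral c) II"
  shows "(norm2 h)\<^sup>2 = c"
  using norm2_sq_has_integral[OF assms(1)] assms(2) by (rule has_integral_unique)

lemma norm2_cmult: "norm2 (\<lambda>x. c * h x) = \<bar>c\<bar> * norm2 h"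
  by (simp add: norm2_def abs_mult power_mult_distrib real_sqrt_mult)

lemma in_L2_spike:
  assumes "in_L2 h" "negligible N" "\<And>x. x \<in> II - N \<Longrightarrow> g x = h x"
  shows "in_L2 g" "norm2 g = norm2 h"
proof -
  show g: "in_L2 g"
    using assms unfolding in_L2_iff
    by (auto intro: measurable_on_spike integrable_spike[where f = "\<lambda>x. (h x)\<^sup>2"])
  have "((\<lambda>x. (g x)\<^sup>2) has_integral (norm2 h)\<^sup>2) II"
    by (rule has_integral_spike[OF assms(2) _ norm2_sq_has_integral[OF assms(1)]]) (simp add: assms(3))
  then have "(norm2 g)\<^sup>2 = (norm2 h)\<^sup>2" by (rule norm2_eqI[OF g])
  then show "norm2 g = norm2 h" by (rule power2_eq_imp_eq) auto
qed

lemma in_L2_cmult: "in_L2 h \<Longrightarrow> in_L2 (\<lambda>x. c * h x)"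
  unfolding in_L2_def by (auto simp: abs_mult power_mult_distrib intro: borel_measurable_times)

lemma in_L2_continuous:
  assumes "continuous_on II h" shows "in_L2 h"
  unfolding in_L2_iff
proof
  show "h measurable_on II"
    using assms by (simp add: measurable_on_iff_borel_measurable continuous_imp_measurable_on_sets_lebesgue)
  show "(\<lambda>x. (h x)\<^sup>2) integrable_on II"
    using assms unfolding II_def by (intro integrable_continuous_interval continuous_intros)
qed

text \<open>The exact integral over the image is kept beside the crude bound by the full norm: for
  \<open>f\<close> itself the share of the chosen piece matters, for its derivative the bound is
  enough.\<close>

lemma in_L2_affine:
  assumes h: "in_L2 h" and m: "m \<noteq> 0" and K: "(\<lambda>x. m * x + c) ` II \<subseteq> II"
  shows "in_L2 (\<lambda>x. h (m * x + c))"
    "\<bar>m\<bar> * (norm2 (\<lambda>x. h (m * x + c)))\<^sup>2 = integral ((\<lambda>x. m * x + c) ` II) (\<lambda>x. (h x)\<^sup>2)"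
    "\<bar>m\<bar> * (norm2 (\<lambda>x. h (m * x + c)))\<^sup>2 \<le> (norm2 h)\<^sup>2"
proof -
  obtain a b where ab: "(\<lambda>x. m * x + c) ` II = cbox a b"
    unfolding II_def image_affinity_atLeastAtMost by (cases "0 \<le> m") auto
  have sub: "cbox a b \<subseteq> cbox (-1) 1" using K unfolding ab by (simp add: II_def)
  have "(\<lambda>x. (h x)\<^sup>2) integrable_on cbox (-1) 1" using h by (simp add: in_L2_iff II_def)
  then have int: "(\<lambda>x. (h x)\<^sup>2) integrable_on cbox a b" by (rule integrable_on_subcbox[OF _ sub])
  define i where "i = integral (cbox a b) (\<lambda>x. (h x)\<^sup>2)"
  have i: "((\<lambda>x. (h x)\<^sup>2) has_integral i) (cbox a b)" unfolding i_def using int by (rule integrable_integral)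
  have im: "(\<lambda>x. (1 / m) *\<^sub>R x + -((1 / m) *\<^sub>R c)) ` cbox a b = II"
    unfolding ab[symmetric] image_image using m by (simp add: field_simps)
  have hi: "((\<lambda>x. (h (m * x + c))\<^sup>2) has_integral i / \<bar>m\<bar>) II"
    using has_integral_affinity[OF i m, of c] unfolding im by simp
  have "(\<lambda>x. if x \<in> II then h x else 0) \<in> borel_measurable lebesgue"
    using h by (simp add: in_L2_def borel_measurable_if_I)
  from borel_measurable_affine[OF this m, of c]
  have "(\<lambda>x. if m * x + c \<in> II then h (m * x + c) else 0) \<in> borel_measurable lebesgue"
    unfolding real_scaleR_def add.commute[of c] .
  then have "(\<lambda>x. if m * x + c \<in> II then h (m * x + c) else 0) \<in> borel_measurable (lebesgue_on II)"
    by (simp add: measurable_restrict_space1)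
  also have "?this \<longleftrightarrow> (\<lambda>x. h (m * x + c)) \<in> borel_measurable (lebesgue_on II)"
    by (intro measurable_cong) (use K in auto)
  finally have "(\<lambda>x. h (m * x + c)) \<in> borel_measurable (lebesgue_on II)" .
  then show L2: "in_L2 (\<lambda>x. h (m * x + c))"
    using hi by (auto simp: in_L2_iff measurable_on_iff_borel_measurable)
  show eq: "\<bar>m\<bar> * (norm2 (\<lambda>x. h (m * x + c)))\<^sup>2 = integral ((\<lambda>x. m * x + c) ` II) (\<lambda>x. (h x)\<^sup>2)"
    unfolding norm2_eqI[OF L2 hi] ab using m by (simp add: i_def)
  have "i \<le> (norm2 h)\<^sup>2"
    by (rule has_integral_subset_le[OF K[unfolded ab] i norm2_sq_has_integral[OF h]]) auto
  then show "\<bar>m\<bar> * (norm2 (\<lambda>x. h (m * x + c)))\<^sup>2 \<le> (norm2 h)\<^sup>2"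
    unfolding eq ab i_def .
qed

lemma vector_derivative_II:
  assumes "x \<in> II" "(h has_real_derivative D) (at x within II)"
  shows "vector_derivative h (at x within II) = D"
  using vector_derivative_within_cbox[of "-1" 1 x h D] assms
  by (simp add: II_def has_real_derivative_iff_has_vector_derivative)

lemma abs_continuous_has_vector_derivative_AE:
  assumes "abs_continuous_on II h"
  obtains N where "negligible N"
    "\<And>x. x \<in> II - N \<Longrightarrow> (h has_real_derivative vector_derivative h (at x within II)) (at x within II)"
proof -
  obtain N where N: "negligible N" "\<And>x. x \<in> II - N \<Longrightarrow> \<exists>D. (h has_real_derivative D) (at x within II)"
    using abs_continuous_on_differentiable_AE[of "-1" 1 h] assms unfolding II_def by metis
  have "(h has_real_derivative vector_derivative h (at x within II)) (at x within II)" if x: "x \<in> II - N" for x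
  proof -
    obtain D where D: "(h has_real_derivative D) (at x within II)" using N(2)[OF x] by blast
    then show ?thesis using vector_derivative_II[OF _ D] x by simp
  qed
  then show ?thesis using that N(1) by blast
qed

lemma abs_continuous_on_cong:
  assumes "\<And>x. x \<in> S \<Longrightarrow> f x = g x"
  shows "abs_continuous_on S f \<longleftrightarrow> abs_continuous_on S g"
proof -
  have "abs_continuous_on S g" if f: "abs_continuous_on S f" and eq: "\<And>x. x \<in> S \<Longrightarrow> f x = g x" for f g
  proof (rule abs_continuous_on_dominated[OF f f, where M = 1])
    fix a b :: real assume "a < b" "{a..b} \<subseteq> S"
    then have "a \<in> S" "b \<in> S" by auto
    then show "\<bar>g b - g a\<bar> \<le> 1 * (\<bar>f b - f a\<bar> + \<bar>f b - f a\<bar>)" using eq[of a] eq[of b] by simp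
  qed
  from this[of f g] this[of g f] show ?thesis using assms by auto
qed

text \<open>Membership is certified by an explicit tower \<open>D\<close> of derivatives. The top
  one has to be right only off a null set, which neither \<open>in_L2\<close> nor
  \<open>norm2\<close> can see.\<close>

lemma L2rI:
  assumes g: "\<And>x. x \<in> II \<Longrightarrow> g x = D 0 x"
    and D: "\<And>j x. j < r - 1 \<Longrightarrow> x \<in> II \<Longrightarrow> (D j has_real_derivative D (Suc j) x) (at x within II)"
    and AC: "abs_continuous_on II (D (r - 1))" and r: "0 < r"
    and N: "negligible N"
    and Dr: "\<And>x. x \<in> II - N \<Longrightarrow> (D (r - 1) has_real_derivative D r x) (at x within II)"
    and L2: "in_L2 (D r)"
  shows "g \<in> L2r r" "\<And>j x. j < r \<Longrightarrow> x \<in> II \<Longrightarrow> ideriv j g x = D j x"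
    "norm2 (ideriv r g) = norm2 (D r)"
proof -
  have transfer: "(ideriv j g has_real_derivative E) (at x within II)"
    if eq: "\<And>x. x \<in> II \<Longrightarrow> ideriv j g x = D j x" and x: "x \<in> II"
      and E: "(D j has_real_derivative E) (at x within II)" for j x E
    by (rule has_field_derivative_transform_within[OF E zero_less_one x]) (simp add: eq)
  have eq: "\<forall>x\<in>II. ideriv j g x = D j x" if "j < r" for j
    using that
  proof (induction j)
    case 0
    then show ?case using g by simp
  next
    case (Suc j)
    then have IH: "\<And>x. x \<in> II \<Longrightarrow> ideriv j g x = D j x" by simp
    show ?case
    proof
      fix x assume x: "x \<in> II"
      have "(ideriv j g has_real_derivative D (Suc j) x) (at x within II)"
        by (rule transfer[OF IH x D]) (use Suc.prems x in auto)
      then show "ideriv (Suc j) g x = D (Suc j) x" using vector_derivative_II[OF x] by simp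
    qed
  qed
  then show eq': "\<And>j x. j < r \<Longrightarrow> x \<in> II \<Longrightarrow> ideriv j g x = D j x" by blast
  have top: "ideriv r g x = D r x" if x: "x \<in> II - N" for x
  proof -
    have "(ideriv (r - 1) g has_real_derivative D r x) (at x within II)"
      using transfer[OF _ _ Dr[OF x]] eq'[of "r - 1"] r x by auto
    then have "ideriv (Suc (r - 1)) g x = D r x" using vector_derivative_II[of x "ideriv (r - 1) g"] x by simp
    then show ?thesis using r by simp
  qed
  show "norm2 (ideriv r g) = norm2 (D r)" by (rule in_L2_spike(2)[OF L2 N top])
  have "in_L2 (ideriv r g)" by (rule in_L2_spike(1)[OF L2 N top])
  moreover have "abs_continuous_on II (ideriv (r - 1) g)"
    using AC eq'[of "r - 1"] r by (subst abs_continuous_on_cong[of II _ "D (r - 1)"]) auto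
  moreover have "ideriv j g differentiable_on II" if j: "j < r - 1" for j
    unfolding differentiable_on_def
  proof
    fix x assume x: "x \<in> II"
    have "(ideriv j g has_real_derivative D (Suc j) x) (at x within II)"
      by (rule transfer[OF _ x D]) (use eq' j x in auto)
    then show "ideriv j g differentiable (at x within II)"
      by (meson has_field_derivative_imp_has_derivative differentiableI)
  qed
  ultimately show "g \<in> L2r r" unfolding L2r_def by blast
qed

lemma L2rD:
  assumes f: "f \<in> L2r r"
  shows "\<And>j x. j < r - 1 \<Longrightarrow> x \<in> II \<Longrightarrow> (ideriv j f has_real_derivative ideriv (Suc j) f x) (at x within II)"
    "abs_continuous_on II (ideriv (r - 1) f)" "in_L2 (ideriv r f)"
    "\<And>j. j < r \<Longrightarrow> continuous_on II (ideriv j f)"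
proof -
  show d: "(ideriv j f has_real_derivative ideriv (Suc j) f x) (at x within II)" if "j < r - 1" "x \<in> II" for j x
  proof -
    have "ideriv j f differentiable (at x within II)" using f that by (auto simp: L2r_def differentiable_on_def)
    then obtain D where D: "(ideriv j f has_real_derivative D) (at x within II)"
      using real_differentiable_def by blast
    then show ?thesis using vector_derivative_II[OF that(2) D] by simp
  qed
  show AC: "abs_continuous_on II (ideriv (r - 1) f)" and "in_L2 (ideriv r f)" using f by (auto simp: L2r_def)
  show "continuous_on II (ideriv j f)" if "j < r" for j
  proof (cases "j < r - 1")
    case True
    then show ?thesis using f by (auto simp: L2r_def intro: differentiable_imp_continuous_on)
  next
    case False
    then have "j = r - 1" using that by simp
    then show ?thesis using abs_continuous_on_imp_continuous_on AC by (simp add: II_def)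
  qed
qed

lemma abs_continuous_on_affine:
  assumes f: "abs_continuous_on S f" and m: "m \<noteq> 0" and S: "(\<lambda>x. m * x + c) ` T \<subseteq> S"
  shows "abs_continuous_on T (\<lambda>x. f (m * x + c))"
  unfolding abs_continuous_on_def
proof (intro allI impI)
  fix e :: real assume "e > 0"
  then obtain d where d: "d > 0" "\<And>P. finite P \<Longrightarrow> (\<forall>(u, v)\<in>P. u < v \<and> {u..v} \<subseteq> S) \<Longrightarrow>
      pairwise (\<lambda>p q. disjnt {fst p<..<snd p} {fst q<..<snd q}) P \<Longrightarrow>
      (\<Sum>(u, v)\<in>P. v - u) < d \<Longrightarrow> (\<Sum>(u, v)\<in>P. \<bar>f v - f u\<bar>) < e"
    using f unfolding abs_continuous_on_def by meson
  show "\<exists>d>0. \<forall>P. finite P \<longrightarrow> (\<forall>(a, b)\<in>P. a < b \<and> {a..b} \<subseteq> T) \<longrightarrow>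
      pairwise (\<lambda>p q. disjnt {fst p<..<snd p} {fst q<..<snd q}) P \<longrightarrow>
      (\<Sum>(a, b)\<in>P. b - a) < d \<longrightarrow> (\<Sum>(a, b)\<in>P. \<bar>f (m * b + c) - f (m * a + c)\<bar>) < e"
  proof (intro exI[of _ "d / \<bar>m\<bar>"] conjI allI impI)
    show "0 < d / \<bar>m\<bar>" using d(1) m by simp
    fix P :: "(real \<times> real) set"
    assume P: "finite P" "\<forall>(a, b)\<in>P. a < b \<and> {a..b} \<subseteq> T"
      "pairwise (\<lambda>p q. disjnt {fst p<..<snd p} {fst q<..<snd q}) P" "(\<Sum>(a, b)\<in>P. b - a) < d / \<bar>m\<bar>"
    \<comment> \<open>For negative \<open>m\<close> the map reverses order, and the end points of
      each interval change places.\<close>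
    define \<psi> where "\<psi> p = (if 0 < m then (m * fst p + c, m * snd p + c) else (m * snd p + c, m * fst p + c))" for p
    have inj: "inj_on \<psi> P" using m by (intro inj_onI) (auto simp: \<psi>_def prod_eq_iff split: if_splits)
    have inv: "(y - c) / m \<in> {fst p<..<snd p}" if "y \<in> {fst (\<psi> p)<..<snd (\<psi> p)}" for y p
      using that m by (auto simp: \<psi>_def field_simps split: if_splits)
    have inv': "(y - c) / m \<in> {fst p..snd p}" if "y \<in> {fst (\<psi> p)..snd (\<psi> p)}" for y p
      using that m by (auto simp: \<psi>_def field_simps split: if_splits)
    have "(\<Sum>(u, v)\<in>\<psi> ` P. \<bar>f v - f u\<bar>) < e"
    proof (rule d(2))
      show "finite (\<psi> ` P)" using P(1) by simp
      show "\<forall>(u, v)\<in>\<psi> ` P. u < v \<and> {u..v} \<subseteq> S"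
      proof clarify
        fix u v p q assume uv: "(u, v) = \<psi> (p, q)" "(p, q) \<in> P"
        then have pq: "p < q" "{p..q} \<subseteq> T" using P(2) by auto
        have "u < v" using uv(1) pq m by (auto simp: \<psi>_def split: if_splits)
        moreover have "{u..v} \<subseteq> S"
        proof
          fix y assume "y \<in> {u..v}"
          then have "(y - c) / m \<in> T" using inv'[of y "(p, q)"] uv(1)[symmetric] pq by auto
          then have "m * ((y - c) / m) + c \<in> S" using S by blast
          then show "y \<in> S" using m by simp
        qed
        ultimately show "u < v \<and> {u..v} \<subseteq> S" by blast
      qed
      show "pairwise (\<lambda>p q. disjnt {fst p<..<snd p} {fst q<..<snd q}) (\<psi> ` P)"
      proof (rule pairwiseI)
        fix i j assume ij: "i \<in> \<psi> ` P" "j \<in> \<psi> ` P" "i \<noteq> j"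
        then obtain p q where pq: "p \<in> P" "q \<in> P" "i = \<psi> p" "j = \<psi> q" "p \<noteq> q" by auto
        have "disjnt {fst p<..<snd p} {fst q<..<snd q}" using pairwiseD[OF P(3) pq(1,2,5)] .
        then show "disjnt {fst i<..<snd i} {fst j<..<snd j}"
          unfolding pq(3,4) using inv[of _ p] inv[of _ q] by (auto simp only: disjnt_iff)
      qed
      have "(\<Sum>(u, v)\<in>\<psi> ` P. v - u) = (\<Sum>(u, v)\<in>P. \<bar>m\<bar> * (v - u))"
        by (subst sum.reindex[OF inj]) (auto simp: \<psi>_def algebra_simps intro!: sum.cong)
      also have "\<dots> = \<bar>m\<bar> * (\<Sum>(u, v)\<in>P. v - u)" by (simp add: sum_distrib_left split_beta)
      also have "\<dots> < d" using P(4) m by (simp add: field_simps)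
      finally show "(\<Sum>(u, v)\<in>\<psi> ` P. v - u) < d" .
    qed
    also have "(\<Sum>(u, v)\<in>\<psi> ` P. \<bar>f v - f u\<bar>) = (\<Sum>(a, b)\<in>P. \<bar>f (m * b + c) - f (m * a + c)\<bar>)"
      by (subst sum.reindex[OF inj]) (auto simp: \<psi>_def abs_minus_commute intro!: sum.cong)
    finally show "(\<Sum>(a, b)\<in>P. \<bar>f (m * b + c) - f (m * a + c)\<bar>) < e" .
  qed
qed

text \<open>The scalar \<open>k\<close> lets one statement serve both the affine pullback
  (\<open>k = 1\<close>) and normalisation (\<open>m = 1\<close>, \<open>c = 0\<close>).\<close>

lemma L2r_affine:
  fixes k m c :: real
  assumes f: "f \<in> L2r r" and r: "0 < r" and m: "m \<noteq> 0" and K: "(\<lambda>x. m * x + c) ` II \<subseteq> II"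
  defines "g \<equiv> \<lambda>x. k * f (m * x + c)"
  shows "g \<in> L2r r" "\<And>j x. j < r \<Longrightarrow> x \<in> II \<Longrightarrow> ideriv j g x = k * m ^ j * ideriv j f (m * x + c)"
    "norm2 (ideriv r g) = \<bar>k * m ^ r\<bar> * norm2 (\<lambda>x. ideriv r f (m * x + c))"
proof -
  define D where "D j x = k * m ^ j * ideriv j f (m * x + c)" for j x
  have aff: "((\<lambda>x. m * x + c) has_real_derivative m) (at x within II)" for x
    by (auto intro!: derivative_eq_intros)
  have chain: "(D j has_real_derivative k * m ^ Suc j * E) (at x within II)"
    if "x \<in> II" "(ideriv j f has_real_derivative E) (at (m * x + c) within II)" for j x E
  proof -
    have "(ideriv j f has_real_derivative E) (at (m * x + c) within (\<lambda>x. m * x + c) ` II)"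
      using that(2) K by (rule DERIV_subset)
    from DERIV_image_chain[OF this aff]
    have "((\<lambda>x. ideriv j f (m * x + c)) has_real_derivative E * m) (at x within II)" by (simp add: o_def)
    from DERIV_cmult[OF this, of "k * m ^ j"] show ?thesis by (simp add: D_def[abs_def] mult_ac)
  qed
  obtain N where N: "negligible N" "\<And>x. x \<in> II - N \<Longrightarrow>
      (ideriv (r - 1) f has_real_derivative vector_derivative (ideriv (r - 1) f) (at x within II)) (at x within II)"
    using abs_continuous_has_vector_derivative_AE[OF L2rD(2)[OF f]] by blast
  define N' where "N' = (\<lambda>x. (x - c) / m) ` N"
  have N': "negligible N'" unfolding N'_def
    by (rule negligible_differentiable_image_negligible[OF _ N(1)])
      (auto simp: differentiable_on_def divide_inverse intro!: derivative_intros)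
  note res = L2rI[of g D r N']
  have "abs_continuous_on II (\<lambda>x. ideriv (r - 1) f (m * x + c))"
    by (rule abs_continuous_on_affine[OF L2rD(2)[OF f] m K])
  from abs_continuous_on_dominated[OF this this, where M = "\<bar>k * m ^ (r - 1)\<bar>"]
  have AC: "abs_continuous_on II (D (r - 1))"
    unfolding D_def by (simp add: right_diff_distrib[symmetric] abs_mult mult_left_mono)
  have 0: "g x = D 0 x" for x by (simp add: g_def D_def)
  have 1: "(D j has_real_derivative D (Suc j) x) (at x within II)" if "j < r - 1" "x \<in> II" for j x
    using chain[OF that(2) L2rD(1)[OF f that(1)]] that(2) K by (auto simp: D_def)
  have 2: "(D (r - 1) has_real_derivative D r x) (at x within II)" if "x \<in> II - N'" for x
  proof -
    have "m * x + c \<in> II - N" using that K m by (auto simp: N'_def image_iff)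
    from chain[OF _ N(2)[OF this]] that r show ?thesis
      by (cases r) (auto simp: D_def)
  qed
  have 3: "in_L2 (D r)" unfolding D_def by (intro in_L2_cmult in_L2_affine(1)[OF L2rD(3)[OF f] m K])
  show "g \<in> L2r r" by (rule res(1)[OF 0 1 AC r N' 2 3])
  show "ideriv j g x = k * m ^ j * ideriv j f (m * x + c)" if "j < r" "x \<in> II" for j x
    using res(2)[OF 0 1 AC r N' 2 3 that] by (simp add: D_def)
  show "norm2 (ideriv r g) = \<bar>k * m ^ r\<bar> * norm2 (\<lambda>x. ideriv r f (m * x + c))"
    using res(3)[OF 0 1 AC r N' 2 3] by (simp add: D_def[abs_def] norm2_cmult)
qed

subsection \<open>From the end point to the interior\<close>

lemma point_bound_of_endpoint_bound_order0:
  assumes r: "0 < r" and A: "0 \<le> A" and B: "0 \<le> B"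
    and P: "\<And>g. g \<in> L2r r \<Longrightarrow> \<bar>g (-1)\<bar> \<le> A * norm2 g + B * norm2 (ideriv r g)"
    and f: "f \<in> L2r r" and t: "t \<in> II"
  shows "\<bar>f t\<bar> \<le> A * norm2 f + B * norm2 (ideriv r f)"
proof -
  have t': "-1 \<le> t" "t \<le> 1" using t by (auto simp: II_def)
  have L2f: "in_L2 f" using in_L2_continuous[OF L2rD(4)[OF f r]] by simp
  define F where "F = (norm2 f)\<^sup>2"
  have hF: "((\<lambda>x. (f x)\<^sup>2) has_integral F) {-1..1}"
    using norm2_sq_has_integral[OF L2f] by (simp add: F_def II_def)
  define l where "l = integral {-1..t} (\<lambda>x. (f x)\<^sup>2)"
  define u where "u = integral {t..1} (\<lambda>x. (f x)\<^sup>2)"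
  have lu: "l + u = F"
    unfolding l_def u_def using Henstock_Kurzweil_Integration.integral_combine[OF t', of "\<lambda>x. (f x)\<^sup>2"] hF
    by (auto simp: integral_unique)
  have lu0: "0 \<le> l" "0 \<le> u" unfolding l_def u_def
    by (intro integral_nonneg integrable_subinterval_real[OF has_integral_integrable[OF hF]], use t' in auto)+
  \<comment> \<open>The map with ratio \<open>m\<close> and shift \<open>t + m\<close> sends -1 to
    \<open>t\<close> for either sign of \<open>m\<close>; a negative \<open>m\<close> means the left
    piece, run backwards.\<close>
  have "\<exists>m. m \<noteq> 0 \<and> \<bar>m\<bar> \<le> 1 \<and> (\<lambda>x. m * x + (t + m)) ` II \<subseteq> II \<and>
      integral ((\<lambda>x. m * x + (t + m)) ` II) (\<lambda>x. (f x)\<^sup>2) \<le> \<bar>m\<bar> * F"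
  proof -
    \<comment> \<open>The relative lengths add up to 1, so one of the pieces carries at most its
      share of the integral; for \<open>t\<close> at an end point the nondegenerate piece is the
      whole interval.\<close>
    have "(t < 1 \<and> u \<le> (1 - t) / 2 * F) \<or> (-1 < t \<and> l \<le> (1 + t) / 2 * F)"
    proof (cases "t < 1 \<and> -1 < t")
      case True
      have "(1 - t) / 2 * F + (1 + t) / 2 * F = l + u" unfolding lu by (simp add: field_simps)
      then show ?thesis using True by linarith
    next
      case False
      then have "t = 1 \<or> t = -1" using t' by auto
      then show ?thesis using lu lu0 by auto
    qed
    then show ?thesis
    proof
      assume *: "t < 1 \<and> u \<le> (1 - t) / 2 * F"
      define m where "m = (1 - t) / 2"
      have "(\<lambda>x. m * x + (t + m)) ` II = {t..1}"
        unfolding II_def image_affinity_atLeastAtMost using * by (simp add: m_def field_simps)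
      then show ?thesis using * t' by (intro exI[of _ m]) (auto simp: m_def u_def II_def)
    next
      assume *: "-1 < t \<and> l \<le> (1 + t) / 2 * F"
      define m where "m = - ((1 + t) / 2)"
      have "(\<lambda>x. m * x + (t + m)) ` II = {-1..t}"
        unfolding II_def image_affinity_atLeastAtMost using * by (simp add: m_def field_simps)
      moreover have am: "\<bar>m\<bar> = (1 + t) / 2" and "m \<noteq> 0" using * by (auto simp: m_def abs_if)
      moreover have "l \<le> \<bar>m\<bar> * F" unfolding am using * by simp
      then have "integral {-1..t} (\<lambda>x. (f x)\<^sup>2) \<le> \<bar>m\<bar> * F" by (simp add: l_def)
      moreover have "\<bar>m\<bar> \<le> 1" unfolding am using t' by simp
      ultimately show ?thesis using t' by (intro exI[of _ m]) (auto simp: II_def)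
    qed
  qed
  then obtain m where m: "m \<noteq> 0" "\<bar>m\<bar> \<le> 1" and K: "(\<lambda>x. m * x + (t + m)) ` II \<subseteq> II"
    and le: "integral ((\<lambda>x. m * x + (t + m)) ` II) (\<lambda>x. (f x)\<^sup>2) \<le> \<bar>m\<bar> * F" by blast
  define g where "g x = 1 * f (m * x + (t + m))" for x
  note aff = L2r_affine[OF f r m(1) K, where k = 1, folded g_def]
  have "\<bar>m\<bar> * (norm2 g)\<^sup>2 \<le> \<bar>m\<bar> * F"
    using in_L2_affine(2)[OF L2f m(1) K] le by (simp add: g_def[abs_def])
  then have "(norm2 g)\<^sup>2 \<le> (norm2 f)\<^sup>2" using m(1) by (simp add: F_def)
  then have 1: "norm2 g \<le> norm2 f" by (rule power2_le_imp_le) simp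
  define n where "n = norm2 (\<lambda>x. ideriv r f (m * x + (t + m)))"
  \<comment> \<open>One factor \<open>\<bar>m\<bar>\<close> pays for the change of variables; the
    remaining power, of exponent \<open>2 * r - 1\<close>, is at most 1.\<close>
  have "(\<bar>m\<bar> ^ r * n)\<^sup>2 = \<bar>m\<bar> ^ (2 * r - 1) * (\<bar>m\<bar> * n\<^sup>2)"
    using r power_minus_mult[of "2 * r" "\<bar>m\<bar>"] by (simp add: power_mult_distrib power_even_eq mult.assoc[symmetric])
  also have "\<dots> \<le> 1 * (\<bar>m\<bar> * n\<^sup>2)" using m(2) by (intro mult_right_mono power_le_one) auto
  also have "\<dots> \<le> (norm2 (ideriv r f))\<^sup>2"
    using in_L2_affine(3)[OF L2rD(3)[OF f] m(1) K] by (simp add: n_def)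
  finally have "\<bar>m\<bar> ^ r * n \<le> norm2 (ideriv r f)" by (rule power2_le_imp_le) simp
  then have 2: "norm2 (ideriv r g) \<le> norm2 (ideriv r f)"
    using aff(3) by (simp add: n_def power_abs)
  have "\<bar>f t\<bar> = \<bar>g (-1)\<bar>" by (simp add: g_def)
  also have "\<dots> \<le> A * norm2 g + B * norm2 (ideriv r g)" by (rule P[OF aff(1)])
  also have "\<dots> \<le> A * norm2 f + B * norm2 (ideriv r f)"
    using 1 2 A B by (intro add_mono mult_left_mono)
  finally show ?thesis .
qed

section \<open>Energies and the beam equation\<close>

lemma green_identity:
  assumes f: "f \<in> L2r 2" and ab: "-1 \<le> a" "a \<le> b" "b \<le> 1"
    and g: "\<And>x. (g2 has_real_derivative g3 x) (at x)" "\<And>x. (g3 has_real_derivative - w * g x) (at x)"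
    and cg: "continuous_on UNIV g"
  shows "((\<lambda>x. w * (f x * g x) + ideriv 2 f x * g2 x) has_integral
     (ideriv 1 f b * g2 b - f b * g3 b) - (ideriv 1 f a * g2 a - f a * g3 a)) {a..b}"
proof -
  have sub: "{a..b} \<subseteq> II" using ab by (auto simp: II_def)
  have f1: "(f has_real_derivative ideriv 1 f x) (at x within {a..b})" if "x \<in> {a..b}" for x
    using DERIV_subset[OF L2rD(1)[OF f, of 0 x] sub] that sub by auto
  have AC1: "abs_continuous_on {a..b} (ideriv 1 f)"
    using L2rD(2)[OF f] sub by (auto intro: abs_continuous_on_subset)
  obtain N where N: "negligible N" "\<And>x. x \<in> II - N \<Longrightarrow> (ideriv 1 f has_real_derivative ideriv 2 f x) (at x within II)"
    using abs_continuous_has_vector_derivative_AE[OF L2rD(2)[OF f]] by (auto simp: numeral_2_eq_2)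
  have g3c: "continuous_on {a..b} g3" using g(2) by (meson DERIV_continuous_on has_field_derivative_at_within)
  have gc: "continuous_on {a..b} (\<lambda>x. - w * g x)" using cg by (intro continuous_intros continuous_on_subset[OF cg]) auto
  \<comment> \<open>\<open>ideriv 1 f\<close> is differentiable only off a null set, so this
    primitive has to be absolutely continuous. In its derivative the two products of
    \<open>ideriv 1 f\<close> and \<open>g3\<close> cancel.\<close>
  have AC: "abs_continuous_on {a..b} (\<lambda>x. ideriv 1 f x * g2 x - f x * g3 x)"
    using g by (intro abs_continuous_on_diff abs_continuous_on_mult AC1
        abs_continuous_on_C1[OF f1] abs_continuous_on_C1[OF _ g3c] abs_continuous_on_C1[OF _ gc]
        abs_continuous_on_imp_continuous_on[OF AC1]) (auto intro: has_field_derivative_at_within)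
  show ?thesis
  proof (rule FTC_abs_continuous[OF ab(2) AC N(1)])
    fix x assume x: "x \<in> {a..b} - N"
    have d2: "(ideriv 1 f has_real_derivative ideriv 2 f x) (at x within {a..b})"
      using DERIV_subset[OF N(2)[of x] sub] x sub by blast
    have "((\<lambda>x. ideriv 1 f x * g2 x - f x * g3 x) has_real_derivative
        (ideriv 2 f x * g2 x + g3 x * ideriv 1 f x) - (ideriv 1 f x * g3 x + - w * g x * f x)) (at x within {a..b})"
      by (intro DERIV_diff DERIV_mult d2 f1 has_field_derivative_at_within[OF g(1)] has_field_derivative_at_within[OF g(2)])
        (use x in auto)
    then show "((\<lambda>x. ideriv 1 f x * g2 x - f x * g3 x) has_real_derivative
        w * (f x * g x) + ideriv 2 f x * g2 x) (at x within {a..b})"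
      by (simp add: algebra_simps)
  qed
qed

text \<open>The diagonal case of \<open>green_identity\<close>; as \<open>g\<close> is smooth, the
  classical fundamental theorem applies.\<close>

lemma beam_energy:
  fixes g :: "real \<Rightarrow> real"
  assumes ab: "a \<le> b"
    and g: "\<And>x. (g has_real_derivative g1 x) (at x)" "\<And>x. (g1 has_real_derivative g2 x) (at x)"
      "\<And>x. (g2 has_real_derivative g3 x) (at x)" "\<And>x. (g3 has_real_derivative - w * g x) (at x)"
  shows "((\<lambda>x. w * (g x)\<^sup>2 + (g2 x)\<^sup>2) has_integral (g1 b * g2 b - g b * g3 b) - (g1 a * g2 a - g a * g3 a)) {a..b}"
proof (rule fundamental_theorem_of_calculus[OF ab])
  fix x assume "x \<in> {a..b}"
  have "((\<lambda>x. g1 x * g2 x - g x * g3 x) has_real_derivative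
      (g2 x * g2 x + g3 x * g1 x) - (g1 x * g3 x + - w * g x * g x)) (at x within {a..b})"
    by (intro DERIV_diff DERIV_mult has_field_derivative_at_within[OF g(1)] has_field_derivative_at_within[OF g(2)]
        has_field_derivative_at_within[OF g(3)] has_field_derivative_at_within[OF g(4)])
  then show "((\<lambda>x. g1 x * g2 x - g x * g3 x) has_vector_derivative w * (g x)\<^sup>2 + (g2 x)\<^sup>2) (at x within {a..b})"
    by (simp add: has_real_derivative_iff_has_vector_derivative[symmetric] algebra_simps power2_eq_square)
qed

lemma energy_has_integral:
  assumes "in_L2 f" "in_L2 h"
  shows "((\<lambda>x. w * (f x)\<^sup>2 + (h x)\<^sup>2) has_integral w * (norm2 f)\<^sup>2 + (norm2 h)\<^sup>2) {-1..1}"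
  using has_integral_add[OF has_integral_mult_right[OF norm2_sq_has_integral[OF assms(1)], of w]
      norm2_sq_has_integral[OF assms(2)]] by (simp add: II_def)

text \<open>This is the energy of f - z g over \<open>{a..b}\<close>, with the cross term and the
  energy of \<open>g\<close> turned into boundary terms. It is applied on each side of t, since the
  representer is smooth only away from t.\<close>

lemma energy_quadratic_nonneg:
  assumes f: "f \<in> L2r 2" and ab: "-1 \<le> a" "a \<le> b" "b \<le> 1" and w: "0 \<le> w"
    and g: "\<And>x. (g has_real_derivative g1 x) (at x)" "\<And>x. (g1 has_real_derivative g2 x) (at x)"
      "\<And>x. (g2 has_real_derivative g3 x) (at x)" "\<And>x. (g3 has_real_derivative - w * g x) (at x)"
  shows "0 \<le> integral {a..b} (\<lambda>x. w * (f x)\<^sup>2 + (ideriv 2 f x)\<^sup>2)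
     - 2 * z * ((ideriv 1 f b * g2 b - f b * g3 b) - (ideriv 1 f a * g2 a - f a * g3 a))
     + z\<^sup>2 * ((g1 b * g2 b - g b * g3 b) - (g1 a * g2 a - g a * g3 a))"
proof -
  have L2: "in_L2 f" "in_L2 (ideriv 2 f)"
    using in_L2_continuous[OF L2rD(4)[OF f, of 0]] L2rD(3)[OF f] by auto
  have "(\<lambda>x. w * (f x)\<^sup>2 + (ideriv 2 f x)\<^sup>2) integrable_on {-1..1}"
    using energy_has_integral[OF L2] by (rule has_integral_integrable)
  then have "(\<lambda>x. w * (f x)\<^sup>2 + (ideriv 2 f x)\<^sup>2) integrable_on {a..b}"
    by (rule integrable_subinterval_real) (use ab in auto)
  then have 1: "((\<lambda>x. w * (f x)\<^sup>2 + (ideriv 2 f x)\<^sup>2) has_integral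
      integral {a..b} (\<lambda>x. w * (f x)\<^sup>2 + (ideriv 2 f x)\<^sup>2)) {a..b}"
    by (rule integrable_integral)
  have cg: "continuous_on UNIV g" using g(1) by (meson DERIV_continuous_on has_field_derivative_at_within)
  note 2 = green_identity[OF f ab g(3,4) cg]
  note 3 = beam_energy[OF ab(2) g]
  from has_integral_add[OF has_integral_diff[OF 1 has_integral_mult_right[OF 2, of "2 * z"]]
      has_integral_mult_right[OF 3, of "z\<^sup>2"]]
  show ?thesis
  proof (rule has_integral_nonneg)
    fix x
    have "w * (f x)\<^sup>2 + (ideriv 2 f x)\<^sup>2 - 2 * z * (w * (f x * g x) + ideriv 2 f x * g2 x) + z\<^sup>2 * (w * (g x)\<^sup>2 + (g2 x)\<^sup>2)
      = w * (f x - z * g x)\<^sup>2 + (ideriv 2 f x - z * g2 x)\<^sup>2"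
      by (simp add: power2_eq_square algebra_simps)
    then show "0 \<le> w * (f x)\<^sup>2 + (ideriv 2 f x)\<^sup>2 - 2 * z * (w * (f x * g x) + ideriv 2 f x * g2 x) + z\<^sup>2 * (w * (g x)\<^sup>2 + (g2 x)\<^sup>2)"
      using w by simp
  qed
qed

text \<open>
  The \<open>j\<close>-th derivative (\<open>j \<le> 3\<close>) of \<open>x \<mapsto> p kry0 (s x + c) + q kry1 (s x + c)\<close>.
\<close>

definition beam :: "nat \<Rightarrow> real \<Rightarrow> real \<Rightarrow> real \<Rightarrow> real \<Rightarrow> real \<Rightarrow> real" where
  "beam j s c p q x = (let X = s * x + c in
     if j = 0 then p * kry0 X + q * kry1 X
     else if j = 1 then s * (- 4 * p * kry3 X + q * kry0 X)
     else if j = 2 then s ^ 2 * (- 4 * p * kry2 X - 4 * q * kry3 X)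
     else s ^ 3 * (- 4 * p * kry1 X - 4 * q * kry2 X))"

lemma DERIV_beam:
  "(beam 0 s c p q has_real_derivative beam 1 s c p q x) (at x)"
  "(beam 1 s c p q has_real_derivative beam 2 s c p q x) (at x)"
  "(beam 2 s c p q has_real_derivative beam 3 s c p q x) (at x)"
  "(beam 3 s c p q has_real_derivative - (4 * s ^ 4) * beam 0 s c p q x) (at x)"
  unfolding beam_def[abs_def] Let_def
  by (auto intro!: derivative_eq_intros DERIV_chain'[OF _ DERIV_kry(1)] DERIV_chain'[OF _ DERIV_kry(2)]
      DERIV_chain'[OF _ DERIV_kry(3)] DERIV_chain'[OF _ DERIV_kry(4)] simp: algebra_simps power_def numeral_eq_Suc)

text \<open>The function \<open>g\<close> is the representer at -1, scaled to the slope d = f'(t).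
  Its energy is d^2 J / E, where \<open>E\<close> is the end slope and \<open>J\<close> the jump;
  the energy of f is at least as large because the slope at t is at most \<open>E\<close>.\<close>

lemma L2r_2_endpoint_transfer:
  assumes \<kappa>: "0 < \<kappa>" and t: "t \<in> II" and f: "f \<in> L2r 2"
  obtains g where "g \<in> L2r 2" "ideriv 1 g (-1) = ideriv 1 f t"
    "4 * \<kappa> ^ 4 * (norm2 g)\<^sup>2 + (norm2 (ideriv 2 g))\<^sup>2 \<le> 4 * \<kappa> ^ 4 * (norm2 f)\<^sup>2 + (norm2 (ideriv 2 f))\<^sup>2"
proof -
  have t': "-1 \<le> t" "t \<le> 1" using t by (auto simp: II_def)
  define w where "w = 4 * \<kappa> ^ 4"
  have w: "0 \<le> w" by (simp add: w_def)
  define U where "U = \<kappa> * (t + 1)"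
  define V where "V = \<kappa> * (1 - t)"
  define Z where "Z = 2 * \<kappa>"
  have UV: "U + V = Z" "0 \<le> U" "0 \<le> V" using \<kappa> t' by (simp_all add: U_def V_def Z_def) (simp add: algebra_simps)
  have Zpos: "0 < Z" using \<kappa> by (simp add: Z_def)
  have k0: "kry0 0 = 1" "kry1 0 = 0" "kry2 0 = 0" "kry3 0 = 0"
    by (simp_all add: kry0_def kry1_def kry2_def kry3_def)
  define J where "J = \<kappa>\<^sup>2 * (sinh Z ^ 2 - sin Z ^ 2)"
  have J: "0 \<le> J"
  proof -
    have "\<bar>sin Z\<bar>\<^sup>2 \<le> (sinh Z)\<^sup>2" using abs_sin_le_sinh[of Z] Zpos by (intro power_mono) auto
    then show ?thesis by (simp add: J_def)
  qed
  define E where "E = \<kappa> * (sinh Z * cosh Z + sin Z * cos Z)"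
  have E: "0 < E" using \<kappa> kern_slope_end_pos[OF Zpos] by (simp add: E_def)
  \<comment> \<open>The arguments \<open>\<kappa> * x + \<kappa>\<close> and
    \<open>- \<kappa> * x + \<kappa>\<close> vanish at -1 and at 1. Since \<open>kry0\<close> and
    \<open>kry1\<close> have vanishing second and third derivatives at 0, the free-end conditions
    hold at both ends.\<close>
  define L where "L j = beam j \<kappa> \<kappa> (cA U V) (cB U V)" for j
  define R where "R j = beam j (- \<kappa>) \<kappa> (- cA V U) (- cB V U)" for j
  have dL: "(L 0 has_real_derivative L 1 x) (at x)" "(L 1 has_real_derivative L 2 x) (at x)"
      "(L 2 has_real_derivative L 3 x) (at x)" "(L 3 has_real_derivative - w * L 0 x) (at x)" for x
    unfolding L_def w_def by (rule DERIV_beam)+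
  have dR: "(R 0 has_real_derivative R 1 x) (at x)" "(R 1 has_real_derivative R 2 x) (at x)"
      "(R 2 has_real_derivative R 3 x) (at x)" "(R 3 has_real_derivative - w * R 0 x) (at x)" for x
    unfolding R_def w_def using DERIV_beam[of "- \<kappa>"] by simp_all
  have XL: "\<kappa> * t + \<kappa> = U" and XR: "- \<kappa> * t + \<kappa> = V" by (simp_all add: U_def V_def algebra_simps)
  have endL: "L 2 (-1) = 0" "L 3 (-1) = 0" by (simp_all add: L_def beam_def k0)
  have endR: "R 2 1 = 0" "R 3 1 = 0" by (simp_all add: R_def beam_def k0)
  define s where "s = L 1 t"
  have L_t: "L 0 t = cA U V * kry0 U + cB U V * kry1 U" "L 1 t = \<kappa> * (- 4 * cA U V * kry3 U + cB U V * kry0 U)"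
    "L 2 t = \<kappa>\<^sup>2 * (- 4 * (cA U V * kry2 U + cB U V * kry3 U))" "L 3 t = \<kappa> ^ 3 * (- 4 * (cA U V * kry1 U + cB U V * kry2 U))"
    unfolding L_def beam_def Let_def XL by (simp_all add: algebra_simps)
  have R_t: "R 0 t = - (cA V U * kry0 V + cB V U * kry1 V)" "R 1 t = \<kappa> * (- 4 * cA V U * kry3 V + cB V U * kry0 V)"
    "R 2 t = \<kappa>\<^sup>2 * (4 * (cA V U * kry2 V + cB V U * kry3 V))" "R 3 t = \<kappa> ^ 3 * (- 4 * (cA V U * kry1 V + cB V U * kry2 V))"
    unfolding R_def beam_def Let_def XR by (simp_all add: algebra_simps)
  have at_t: "R 0 t = L 0 t" "R 1 t = s" "R 3 t = L 3 t"
    unfolding s_def L_t R_t kern_value[of U V] kern_slope[of U V] kern_third[of U V] by simp_all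
  have "L 2 t - R 2 t = J"
    unfolding L_t R_t J_def UV(1)[symmetric] kern_jump[of U V, symmetric] by (simp add: algebra_simps)
  then have at_t4: "L 2 t = R 2 t + J" by simp
  have s: "s \<le> E"
    unfolding s_def L_t E_def using kern_slope_le[OF UV(2,3)] \<kappa> unfolding UV(1)
    by (intro mult_left_mono) auto
  define e where "e = w * (norm2 f)\<^sup>2 + (norm2 (ideriv 2 f))\<^sup>2"
  have L2: "in_L2 f" "in_L2 (ideriv 2 f)"
    using in_L2_continuous[OF L2rD(4)[OF f, of 0]] L2rD(3)[OF f] by auto
  have split: "integral {-1..t} (\<lambda>x. w * (f x)\<^sup>2 + (ideriv 2 f x)\<^sup>2) + integral {t..1} (\<lambda>x. w * (f x)\<^sup>2 + (ideriv 2 f x)\<^sup>2) = e"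
    using Henstock_Kurzweil_Integration.integral_combine[OF t' has_integral_integrable[OF energy_has_integral[OF L2]]]
      integral_unique[OF energy_has_integral[OF L2]] by (simp add: e_def)
  define d where "d = ideriv 1 f t"
  \<comment> \<open>The energies of f - z L on the left and of f - z R on the right are added.
    Values, slopes and third derivatives match at t, so only the jump \<open>J\<close> of the second
    derivative survives.\<close>
  have quad: "0 \<le> e - 2 * z * (d * J) + z\<^sup>2 * (s * J)" for z
  proof -
    have 1: "0 \<le> integral {-1..t} (\<lambda>x. w * (f x)\<^sup>2 + (ideriv 2 f x)\<^sup>2)
      - 2 * z * (d * L 2 t - f t * L 3 t) + z\<^sup>2 * (s * L 2 t - L 0 t * L 3 t)"
      using energy_quadratic_nonneg[OF f _ t' w dL, of z] by (simp add: endL d_def s_def del: One_nat_def)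
    have 2: "0 \<le> integral {t..1} (\<lambda>x. w * (f x)\<^sup>2 + (ideriv 2 f x)\<^sup>2)
      - 2 * z * (- (d * R 2 t - f t * L 3 t)) + z\<^sup>2 * (- (s * R 2 t - L 0 t * L 3 t))"
      using energy_quadratic_nonneg[OF f t' _ w dR, of z] by (simp add: endR d_def at_t(1-3) del: One_nat_def)
    have "e - 2 * z * (d * J) + z\<^sup>2 * (s * J) =
      (integral {-1..t} (\<lambda>x. w * (f x)\<^sup>2 + (ideriv 2 f x)\<^sup>2)
        - 2 * z * (d * L 2 t - f t * L 3 t) + z\<^sup>2 * (s * L 2 t - L 0 t * L 3 t)) +
      (integral {t..1} (\<lambda>x. w * (f x)\<^sup>2 + (ideriv 2 f x)\<^sup>2)
        - 2 * z * (- (d * R 2 t - f t * L 3 t)) + z\<^sup>2 * (- (s * R 2 t - L 0 t * L 3 t)))"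
      unfolding split[symmetric] at_t4 by (simp add: algebra_simps)
    then show ?thesis using 1 2 by linarith
  qed
  \<comment> \<open>Bounding \<open>s\<close> by \<open>E\<close> first permits the choice z = d / E
    and avoids a division by \<open>s\<close>.\<close>
  have main: "d\<^sup>2 * J / E \<le> e"
  proof -
    have "z\<^sup>2 * (s * J) \<le> z\<^sup>2 * (E * J)" for z
      using s J by (intro mult_left_mono mult_right_mono) auto
    from this[of "d / E"] quad[of "d / E"]
    have "0 \<le> e - 2 * (d / E) * (d * J) + (d / E)\<^sup>2 * (E * J)" by linarith
    also have "\<dots> = e - d\<^sup>2 * J / E" using E by (simp add: field_simps power2_eq_square)
    finally show ?thesis by linarith
  qed
  define q where "q = d / E"
  \<comment> \<open>The right piece for t at -1, where the distances are 0 and \<open>Z\<close>; the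
    factor \<open>q\<close> gives it slope \<open>d\<close> at -1.\<close>
  define G where "G j x = q * beam j (- \<kappa>) \<kappa> (- cA Z 0) (- cB Z 0) x" for j x
  have dG: "(G 0 has_real_derivative G 1 x) (at x)" "(G 1 has_real_derivative G 2 x) (at x)"
      "(G 2 has_real_derivative G 3 x) (at x)" "(G 3 has_real_derivative - w * G 0 x) (at x)" for x
    unfolding G_def w_def using DERIV_cmult[OF DERIV_beam(1), of q "- \<kappa>"] DERIV_cmult[OF DERIV_beam(2), of q "- \<kappa>"]
      DERIV_cmult[OF DERIV_beam(3), of q "- \<kappa>"] DERIV_cmult[OF DERIV_beam(4), of q "- \<kappa>"]
    by (simp_all add: algebra_simps)
  have cG: "continuous_on UNIV (G 0)" "continuous_on UNIV (G 1)" "continuous_on UNIV (G 2)" "continuous_on UNIV (G 3)"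
    using dG by (meson DERIV_continuous_on has_field_derivative_at_within)+
  have XG: "- \<kappa> * (-1) + \<kappa> = Z" by (simp add: Z_def)
  have G_m1: "G 1 (-1) = q * (\<kappa> * (- 4 * cA Z 0 * kry3 Z + cB Z 0 * kry0 Z))"
    "G 2 (-1) = - (q * (\<kappa>\<^sup>2 * (- 4 * (cA Z 0 * kry2 Z + cB Z 0 * kry3 Z))))"
    "G 3 (-1) = q * (\<kappa> ^ 3 * (- 4 * (cA Z 0 * kry1 Z + cB Z 0 * kry2 Z)))"
    unfolding G_def beam_def Let_def XG by (simp_all add: algebra_simps)
  have "- 4 * cA Z 0 * kry3 Z + cB Z 0 * kry0 Z = sinh Z * cosh Z + sin Z * cos Z"
    using kern_slope[of 0 Z] kern_slope_end[of Z] by (simp add: k0)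
  moreover have "- 4 * (cA Z 0 * kry2 Z + cB Z 0 * kry3 Z) = sinh Z ^ 2 - sin Z ^ 2"
    using kern_jump[of 0 Z] by (simp add: k0)
  moreover have "cA Z 0 * kry1 Z + cB Z 0 * kry2 Z = 0"
    using kern_third[of 0 Z] by (simp add: k0)
  ultimately have G_end: "G 1 (-1) = q * E" "G 2 (-1) = - (q * J)" "G 3 (-1) = 0"
    unfolding G_m1 E_def J_def by simp_all
  have G_1: "G 2 1 = 0" "G 3 1 = 0" by (simp_all add: G_def beam_def k0)
  have AC: "abs_continuous_on II (G (2 - 1))"
    unfolding II_def using dG(2) cG(3)
    by (intro abs_continuous_on_C1[of _ _ _ "G 2"]) (auto intro: has_field_derivative_at_within continuous_on_subset)
  have DG: "(G j has_real_derivative G (Suc j) x) (at x within II)" if "j < 2" for j x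
  proof -
    have "j = 0 \<or> j = 1" using that by auto
    then show ?thesis using dG(1,2)[of x] by (auto simp: numeral_2_eq_2 intro: has_field_derivative_at_within)
  qed
  have L2G: "in_L2 (G 0)" "in_L2 (G 2)"
    using cG by (auto intro!: in_L2_continuous intro: continuous_on_subset)
  note mem = L2rI[of "G 0" G 2 "{}", OF refl DG AC _ _ _ L2G(2)]
  have "G 0 \<in> L2r 2" by (rule mem(1)) (use DG[of 1] in \<open>auto simp: numeral_2_eq_2\<close>)
  moreover have "ideriv 1 (G 0) (-1) = G 1 (-1)"
    by (rule mem(2)) (use DG[of 1] in \<open>auto simp: numeral_2_eq_2 II_def\<close>)
  then have "ideriv 1 (G 0) (-1) = ideriv 1 f t" using G_end(1) E by (simp add: q_def d_def del: One_nat_def)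
  moreover have n2: "norm2 (ideriv 2 (G 0)) = norm2 (G 2)"
    by (rule mem(3)) (use DG[of 1] in \<open>auto simp: numeral_2_eq_2\<close>)
  have "w * (norm2 (G 0))\<^sup>2 + (norm2 (G 2))\<^sup>2 = q * E * (q * J)"
    using has_integral_unique[OF energy_has_integral[OF L2G] beam_energy[OF _ dG]] by (simp add: G_end G_1 del: One_nat_def)
  then have "w * (norm2 (G 0))\<^sup>2 + (norm2 (ideriv 2 (G 0)))\<^sup>2 = d\<^sup>2 * J / E"
    unfolding n2 using E by (simp add: q_def power2_eq_square)
  then have "4 * \<kappa> ^ 4 * (norm2 (G 0))\<^sup>2 + (norm2 (ideriv 2 (G 0)))\<^sup>2 \<le> 4 * \<kappa> ^ 4 * (norm2 f)\<^sup>2 + (norm2 (ideriv 2 f))\<^sup>2"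
    using main by (simp add: w_def e_def)
  ultimately show ?thesis by (rule that)
qed

lemma weighted_Cauchy_Schwarz_bound:
  fixes p q X Y :: real
  assumes "0 \<le> p" "0 \<le> q" "p * X\<^sup>2 + q * Y\<^sup>2 \<le> p + q"
  shows "p * X + q * Y \<le> p + q"
proof -
  have "(p * X + q * Y)\<^sup>2 = (p + q) * (p * X\<^sup>2 + q * Y\<^sup>2) - p * q * (X - Y)\<^sup>2"
    by (simp add: power2_eq_square algebra_simps)
  also have "\<dots> \<le> (p + q) * (p * X\<^sup>2 + q * Y\<^sup>2)" using assms by simp
  also have "\<dots> \<le> (p + q) * (p + q)" using assms by (intro mult_left_mono) auto
  finally have "(p * X + q * Y)\<^sup>2 \<le> (p + q)\<^sup>2" by (simp add: power2_eq_square)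
  then show ?thesis by (rule power2_le_imp_le) (use assms in auto)
qed

lemma point_bound_of_endpoint_bound_order1:
  assumes A: "0 \<le> A" and B: "0 \<le> B"
    and P: "\<And>g. g \<in> L2r 2 \<Longrightarrow> \<bar>ideriv 1 g (-1)\<bar> \<le> A * norm2 g + B * norm2 (ideriv 2 g)"
    and f: "f \<in> L2r 2" and t: "t \<in> II"
  shows "\<bar>ideriv 1 f t\<bar> \<le> A * norm2 f + B * norm2 (ideriv 2 f)"
proof -
  define a where "a = norm2 f"
  define b where "b = norm2 (ideriv 2 f)"
  have ab: "0 \<le> a" "0 \<le> b" by (simp_all add: a_def b_def)
  \<comment> \<open>All four numbers are raised by \<open>e\<close> so that the weight is a positive
    quotient even when some of them vanish; \<open>e\<close> tends to 0 at the end.\<close>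
  have bound: "\<bar>ideriv 1 f t\<bar> \<le> (A + e) * (a + e) + (B + e) * (b + e)" if e: "0 < e" for e
  proof -
    define A' B' a' b' where "A' = A + e" and "B' = B + e" and "a' = a + e" and "b' = b + e"
    have pos: "0 < A'" "0 < B'" "0 < a'" "0 < b'" using A B ab e by (auto simp: A'_def B'_def a'_def b'_def)
    \<comment> \<open>With the weight W = 4 \<kappa>^4, the terms W a'^2 and b'^2 are in the ratio
      of \<open>A' * a'\<close> and \<open>B' * b'\<close>, the case of equality in the
      Cauchy-Schwarz inequality.\<close>
    define \<kappa> where "\<kappa> = root 4 (A' * b' / (4 * a' * B'))"
    have \<kappa>: "0 < \<kappa>" "4 * \<kappa> ^ 4 = A' * b' / (a' * B')" using pos by (auto simp: \<kappa>_def)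
    obtain g where g: "g \<in> L2r 2" "ideriv 1 g (-1) = ideriv 1 f t"
      "4 * \<kappa> ^ 4 * (norm2 g)\<^sup>2 + (norm2 (ideriv 2 g))\<^sup>2 \<le> 4 * \<kappa> ^ 4 * a\<^sup>2 + b\<^sup>2"
      using L2r_2_endpoint_transfer[OF \<kappa>(1) t f] unfolding a_def b_def by metis
    define x y where "x = norm2 g" and "y = norm2 (ideriv 2 g)"
    have xy: "0 \<le> x" "0 \<le> y" by (simp_all add: x_def y_def)
    define W where "W = A' * b' / (a' * B')"
    have W: "0 < W" using pos by (simp add: W_def)
    have "W * x\<^sup>2 + y\<^sup>2 \<le> W * a\<^sup>2 + b\<^sup>2" using g(3) unfolding \<kappa>(2) W_def x_def y_def .
    also have "\<dots> \<le> W * a'\<^sup>2 + b'\<^sup>2"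
      using W ab e by (intro add_mono mult_left_mono power_mono) (auto simp: a'_def b'_def)
    finally have "B' / b' * (W * x\<^sup>2 + y\<^sup>2) \<le> B' / b' * (W * a'\<^sup>2 + b'\<^sup>2)"
      using pos by (intro mult_left_mono) auto
    also have "B' / b' * (W * a'\<^sup>2 + b'\<^sup>2) = A' * a' + B' * b'"
      using pos by (simp add: W_def field_simps power2_eq_square)
    also have "B' / b' * (W * x\<^sup>2 + y\<^sup>2) = (A' * a') * (x / a')\<^sup>2 + (B' * b') * (y / b')\<^sup>2"
      using pos by (simp add: W_def field_simps power2_eq_square)
    finally have key: "(A' * a') * (x / a')\<^sup>2 + (B' * b') * (y / b')\<^sup>2 \<le> A' * a' + B' * b'" .
    have "(A' * a') * (x / a') + (B' * b') * (y / b') \<le> A' * a' + B' * b'"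
      by (rule weighted_Cauchy_Schwarz_bound[OF _ _ key]) (use pos in auto)
    then have le: "A' * x + B' * y \<le> A' * a' + B' * b'" using pos by simp
    have "\<bar>ideriv 1 f t\<bar> \<le> A * x + B * y" using P[OF g(1)] unfolding g(2) x_def y_def .
    also have "\<dots> \<le> A' * x + B' * y" using xy e by (intro add_mono mult_right_mono) (auto simp: A'_def B'_def)
    finally show ?thesis using le by (simp add: A'_def B'_def a'_def b'_def)
  qed
  have "((\<lambda>e. (A + e) * (a + e) + (B + e) * (b + e)) \<longlongrightarrow> (A + 0) * (a + 0) + (B + 0) * (b + 0)) (at_right 0)"
    by (intro tendsto_intros)
  moreover have "\<forall>\<^sub>F e in at_right 0. \<bar>ideriv 1 f t\<bar> \<le> (A + e) * (a + e) + (B + e) * (b + e)"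
    using eventually_at_right_less[of "0::real"] by eventually_elim (rule bound)
  ultimately have "\<bar>ideriv 1 f t\<bar> \<le> (A + 0) * (a + 0) + (B + 0) * (b + 0)"
    by (rule tendsto_lowerbound) simp
  then show ?thesis by (simp add: a_def b_def)
qed

section \<open>Essential suprema and sharpness\<close>

lemma norm_infty_le:
  assumes "continuous_on II h" "\<And>x. x \<in> II \<Longrightarrow> \<bar>h x\<bar> \<le> c"
  shows "norm_infty h \<le> ereal c"
  unfolding norm_infty_def
proof (rule esssup_I)
  have "h \<in> borel_measurable (lebesgue_on II)"
    using assms(1) by (simp add: continuous_imp_measurable_on_sets_lebesgue)
  then show "(\<lambda>x. ereal \<bar>h x\<bar>) \<in> borel_measurable (lebesgue_on II)" by measurable
  show "AE x in lebesgue_on II. ereal \<bar>h x\<bar> \<le> ereal c" using assms(2) by (auto intro!: AE_I2)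
qed

text \<open>If the essential supremum were smaller, continuity would keep
  \<open>\<bar>h x\<bar>\<close> above an intermediate constant on an interval to the right of -1,
  which has positive measure.\<close>

lemma abs_endpoint_le_norm_infty:
  assumes h: "continuous_on II h"
  shows "ereal \<bar>h (-1)\<bar> \<le> norm_infty h"
proof (rule ccontr)
  assume "\<not> ereal \<bar>h (-1)\<bar> \<le> norm_infty h"
  then have "norm_infty h < ereal \<bar>h (-1)\<bar>" by simp
  then obtain c where c: "norm_infty h < ereal c" "ereal c < ereal \<bar>h (-1)\<bar>" using ereal_dense2 by blast
  have "AE x in lebesgue_on II. ereal \<bar>h x\<bar> \<le> norm_infty h" unfolding norm_infty_def by (rule esssup_AE)
  then have "AE x in lebesgue_on II. \<bar>h x\<bar> < c"
    by eventually_elim (metis c(1) le_less_trans less_ereal.simps(1))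
  then have "AE x in lebesgue. x \<in> II \<longrightarrow> \<bar>h x\<bar> < c" by (simp add: AE_restrict_space_iff)
  then obtain N where N: "negligible N" "{x. \<not> (x \<in> II \<longrightarrow> \<bar>h x\<bar> < c)} \<subseteq> N"
    unfolding eventually_ae_filter_negligible by blast
  have "((\<lambda>x. \<bar>h x\<bar>) \<longlongrightarrow> \<bar>h (-1)\<bar>) (at (-1) within II)"
    using h by (intro tendsto_intros) (auto simp: continuous_on_def II_def)
  then have "\<forall>\<^sub>F x in at (-1) within II. c < \<bar>h x\<bar>" using c(2) by (intro order_tendstoD(1)) auto
  then obtain d where d: "0 < d" "\<And>x. x \<in> II \<Longrightarrow> x \<noteq> -1 \<Longrightarrow> dist x (-1) < d \<Longrightarrow> c < \<bar>h x\<bar>"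
    unfolding eventually_at by blast
  have "{-1<..<min 1 (-1 + d)} \<subseteq> N"
  proof
    fix x assume x: "x \<in> {-1<..<min 1 (-1 + d)}"
    then have "c < \<bar>h x\<bar>" by (intro d(2)) (auto simp: II_def dist_real_def)
    then show "x \<in> N" using N(2) x by (auto simp: II_def)
  qed
  then have "negligible {-1<..<min 1 (-1 + d)}" using N(1) negligible_subset by blast
  moreover have "{-1<..<min 1 (-1 + d)} \<noteq> {}" using d(1) by simp
  ultimately show False using open_not_negligible[of "{-1<..<min 1 (-1 + d)}"] by simp
qed

text \<open>By homogeneity: dividing f by the norm of its r-th derivative brings it into
  \<open>W2r r\<close>.\<close>

lemma endpoint_bound_of_SUP:
  assumes r: "0 < r" and k: "k < r" and C: "0 \<le> C"
    and S: "\<And>f. f \<in> W2r r \<Longrightarrow> \<bar>ideriv k f (-1)\<bar> - A * norm2 f \<le> C" and f: "f \<in> L2r r"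
  shows "\<bar>ideriv k f (-1)\<bar> \<le> A * norm2 f + C * norm2 (ideriv r f)"
proof -
  define n where "n = norm2 (ideriv r f)"
  have n: "0 \<le> n" by (simp add: n_def)
  have bound: "\<bar>ideriv k f (-1)\<bar> \<le> A * norm2 f + C * (n + e)" if e: "0 < e" for e
  proof -
    \<comment> \<open>Adding \<open>e\<close> covers functions whose r-th derivative has norm 0; the
      bound follows as \<open>e\<close> tends to 0.\<close>
    define c where "c = 1 / (n + e)"
    have c: "0 < c" "c * n \<le> 1" using n e by (auto simp: c_def field_simps)
    define g where "g x = c * f (1 * x + 0)" for x
    have img: "(\<lambda>x. 1 * x + 0) ` II \<subseteq> II" by simp
    note aff = L2r_affine[OF f r one_neq_zero img, where k = c, folded g_def]
    have "norm2 (ideriv r g) = c * n" using aff(3) c by (simp add: n_def)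
    then have "g \<in> W2r r" using aff(1) c(2) by (simp add: W2r_def)
    from S[OF this] have "\<bar>c * ideriv k f (-1)\<bar> - A * norm2 g \<le> C"
      using aff(2)[of k "-1"] k by (simp add: II_def)
    moreover have "norm2 g = c * norm2 f" using norm2_cmult[of c f] c by (simp add: g_def[abs_def])
    ultimately have "c * (\<bar>ideriv k f (-1)\<bar> - A * norm2 f) \<le> C" using c by (simp add: abs_mult algebra_simps)
    then have "\<bar>ideriv k f (-1)\<bar> - A * norm2 f \<le> C * (n + e)" using n e by (simp add: c_def field_simps)
    then show ?thesis by simp
  qed
  have "((\<lambda>e. A * norm2 f + C * (n + e)) \<longlongrightarrow> A * norm2 f + C * (n + 0)) (at_right 0)"
    by (intro tendsto_intros)
  moreover have "\<forall>\<^sub>F e in at_right 0. \<bar>ideriv k f (-1)\<bar> \<le> A * norm2 f + C * (n + e)"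
    using eventually_at_right_less[of "0::real"] by eventually_elim (rule bound)
  ultimately have "\<bar>ideriv k f (-1)\<bar> \<le> A * norm2 f + C * (n + 0)"
    by (rule tendsto_lowerbound) simp
  then show ?thesis by (simp add: n_def)
qed

theorem theorem8:
  fixes r k :: nat
  assumes "(r = 1 \<and> k = 0) \<or> (r = 2 \<and> k \<in> {0, 1})"
  shows "Gamma_D k r = Gamma_D_m1 k r"
proof -
  have r: "0 < r" and k: "k < r" using assms by auto
  define ptw where "ptw A C \<longleftrightarrow> (\<forall>f\<in>L2r r. \<bar>ideriv k f (-1)\<bar> \<le> A * norm2 f + C * norm2 (ideriv r f))" for A C
  define sup where "sup A C \<longleftrightarrow> (\<forall>f\<in>L2r r. norm_infty (ideriv k f) \<le> ereal (A * norm2 f + C * norm2 (ideriv r f)))" for A C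
  define Sm where "Sm A = (SUP f\<in>W2r r. ereal (\<bar>ideriv k f (-1)\<bar> - A * norm2 f))" for A
  define Si where "Si A = (SUP f\<in>W2r r. norm_infty (ideriv k f) - ereal (A * norm2 f))" for A
  have endp: "ereal \<bar>ideriv k f (-1)\<bar> \<le> norm_infty (ideriv k f)" if "f \<in> L2r r" for f
    by (rule abs_endpoint_le_norm_infty[OF L2rD(4)[OF that k]])
  have "Sm A \<le> Si A" for A
    unfolding Sm_def Si_def
  proof (rule SUP_subset_mono[OF order_refl])
    fix f assume "f \<in> W2r r"
    then have "ereal \<bar>ideriv k f (-1)\<bar> \<le> norm_infty (ideriv k f)" using endp by (simp add: W2r_def)
    from ereal_minus_mono[OF this order_refl[of "ereal (A * norm2 f)"]]
    show "ereal (\<bar>ideriv k f (-1)\<bar> - A * norm2 f) \<le> norm_infty (ideriv k f) - ereal (A * norm2 f)" by simp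
  qed
  have sup_ptw: "ptw A C" if "sup A C" for A C
    unfolding ptw_def
  proof
    fix f assume f: "f \<in> L2r r"
    then have "ereal \<bar>ideriv k f (-1)\<bar> \<le> ereal (A * norm2 f + C * norm2 (ideriv r f))"
      using endp[OF f] that unfolding sup_def by (meson order_trans)
    then show "\<bar>ideriv k f (-1)\<bar> \<le> A * norm2 f + C * norm2 (ideriv r f)" by simp
  qed
  have ptw_sup: "sup A C" if "ptw A C" "0 \<le> A" "0 \<le> C" for A C
    unfolding sup_def
  proof
    fix f assume f: "f \<in> L2r r"
    have "\<bar>ideriv k f t\<bar> \<le> A * norm2 f + C * norm2 (ideriv r f)" if t: "t \<in> II" for t
    proof (cases "k = 0")
      case True
      then show ?thesis
        using point_bound_of_endpoint_bound_order0[OF r \<open>0 \<le> A\<close> \<open>0 \<le> C\<close> _ f t] \<open>ptw A C\<close> by (simp add: ptw_def)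
    next
      case False
      then have "k = 1" "r = 2" using assms by auto
      then show ?thesis
        using point_bound_of_endpoint_bound_order1[OF \<open>0 \<le> A\<close> \<open>0 \<le> C\<close> _ _ t] f \<open>ptw A C\<close>
        by (simp add: ptw_def del: One_nat_def)
    qed
    then show "norm_infty (ideriv k f) \<le> ereal (A * norm2 f + C * norm2 (ideriv r f))"
      by (intro norm_infty_le L2rD(4)[OF f k])
  qed
  have Si_le: "Si A \<le> ereal C" if "sup A C" "0 \<le> C" for A C
    unfolding Si_def
  proof (rule SUP_least)
    fix f assume f: "f \<in> W2r r"
    have "norm_infty (ideriv k f) \<le> ereal (A * norm2 f + C * norm2 (ideriv r f))"
      using that f by (simp add: sup_def W2r_def)
    also have "\<dots> \<le> ereal (C + A * norm2 f)"
      using f mult_left_mono[of "norm2 (ideriv r f)" 1 C] \<open>0 \<le> C\<close> by (simp add: W2r_def)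
    finally show "norm_infty (ideriv k f) - ereal (A * norm2 f) \<le> ereal C"
      by (simp add: ereal_minus_le)
  qed
  \<comment> \<open>The zero function keeps \<open>Sm A\<close> from being negative or -\<infinity>,
    so that a finite \<open>Sm A\<close> can serve as a constant.\<close>
  have Sm_nonneg: "0 \<le> Sm A" for A
  proof -
    obtain f where f: "f \<in> W2r r" "ideriv k f (-1) = 0" "norm2 f = 0"
    proof -
      define D :: "nat \<Rightarrow> real \<Rightarrow> real" where "D j x = 0" for j x
      have D: "abs_continuous_on II (D j)" for j
        unfolding II_def D_def by (rule abs_continuous_on_C1[of _ _ _ "\<lambda>_. 0"]) auto
      have "in_L2 (D j)" for j unfolding D_def by (rule in_L2_continuous) auto
      note res = L2rI[of "\<lambda>_. 0" D r "{}", OF _ _ D r _ _ this]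
      have "(\<lambda>_. 0) \<in> L2r r" by (rule res(1)) (auto simp: D_def[abs_def])
      moreover have "ideriv k (\<lambda>_. 0) (-1) = D k (-1)" by (rule res(2)) (use k in \<open>auto simp: D_def[abs_def] II_def\<close>)
      moreover have "norm2 (ideriv r (\<lambda>_. 0)) = norm2 (D r)" by (rule res(3)) (auto simp: D_def[abs_def])
      ultimately show ?thesis by (intro that[of "\<lambda>_. 0"]) (auto simp: W2r_def D_def[abs_def] norm2_def)
    qed
    show ?thesis unfolding Sm_def by (rule SUP_upper2[OF f(1)]) (simp add: f(2,3))
  qed
  have "sup A B \<and> ereal B = Si A \<longleftrightarrow> ptw A B \<and> ereal B = Sm A" if AB: "0 \<le> A" "0 \<le> B" for A B
  proof
    assume "ptw A B \<and> ereal B = Sm A"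
    then show "sup A B \<and> ereal B = Si A"
      using ptw_sup[of A B] Si_le[of A B] \<open>Sm A \<le> Si A\<close> AB by (metis antisym)
  next
    assume *: "sup A B \<and> ereal B = Si A"
    then have "Sm A \<le> ereal B" using \<open>Sm A \<le> Si A\<close> by simp
    \<comment> \<open>A priori \<open>C\<close> may be smaller than \<open>B\<close>. Once
      \<open>C\<close> is shown admissible at -1, it is admissible for the essential supremum too,
      so \<open>Si A\<close> cannot exceed it.\<close>
    then obtain C where C: "Sm A = ereal C" "0 \<le> C" using Sm_nonneg[of A] by (cases "Sm A") auto
    have "\<bar>ideriv k f (-1)\<bar> - A * norm2 f \<le> C" if "f \<in> W2r r" for f
      using SUP_upper[OF that, of "\<lambda>f. ereal (\<bar>ideriv k f (-1)\<bar> - A * norm2 f)"] C(1) unfolding Sm_def by simp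
    then have "ptw A C" unfolding ptw_def using endpoint_bound_of_SUP[OF r k C(2)] by blast
    then have "Si A \<le> Sm A" using Si_le[OF ptw_sup] AB C by simp
    then show "ptw A B \<and> ereal B = Sm A" using * sup_ptw[of A B] \<open>Sm A \<le> Si A\<close> by (metis antisym)
  qed
  then show ?thesis
    unfolding Gamma_D_def Gamma_D_m1_def sup_def ptw_def Sm_def Si_def by auto
qed

end
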